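(* For $\rho\in(0,1]$ let $\sigma^*=\sigma^*(\rho)\geq 0$ be defined by $$(\sigma^* )^2=\sup_{t\in\mathbb{R}\setminus\{0\}}\frac{2}{t^2}\log\left[(1-\rho^2)+\frac{\rho^2}{2}\exp(t/\rho)+\frac{\rho^2}{2}\exp(-t/\rho)\right].$$ If $\rho\ge1/\sqrt3$, then $\sigma^*=1$, and consequently, for every $0\le\lambda<1$, $\mathrm{GWig}_n(\lambda,\mathcal{X})$ is contiguous to $\mathrm{GWig}_n(0)$, where $\mathcal{X}=\mathrm{iid}(\sqrt{1/\rho}\,\mathcal{R}(\rho))$ is the sparse Rademacher prior. On the other hand, if $\rho<1/\sqrt3$, then $\sigma^*>1$.
   Context: $\mathcal{R}(\rho)$ is the sparse Rademacher distribution: value $0$ with probability $1-\rho$, and values $+1$ and $-1$ each with probability $\rho/2$. The prior $\mathrm{iid}(\sqrt{1/\rho}\,\mathcal{R}(\rho))$ is the family $\{\mathcal{X}_n\}$ in which the coordinates of $x\in\mathbb{R}^n$ are independent, each distributed as $\frac{1}{\sqrt n}\sqrt{1/\rho}\,\mathcal{R}(\rho)$. (The number $(\sigma^* )^2$ is the smallest variance proxy $\sigma^2$ such that $\mathbb{E}\exp(t\pi\pi')\le\exp(\frac12\sigma^2t^2)$ for all $t\in\mathbb{R}$, where $\pi,\pi'$ are independent copies of $\sqrt{1/\rho}\,\mathcal{R}(\rho)$.) For $\lambda\ge0$, $\mathrm{GWig}_n(\lambda,\mathcal{X})$ is the law of the $n\times n$ matrix $Y=\lambda xx^\top+\frac{1}{\sqrt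 n}W$, where $x\sim\mathcal{X}_n$ and, independently of $x$, $W$ is an $n\times n$ GOE matrix: random symmetric, off-diagonal entries $\mathcal{N}(0,1)$, diagonal entries $\mathcal{N}(0,2)$, all entries independent except for $W_{ij}=W_{ji}$. $\mathrm{GWig}_n(0)$ denotes the case $\lambda=0$. Contiguity: for sequences of probability measures $P_n,Q_n$ on measurable spaces $(\Omega_n,\mathcal{F}_n)$, $P_n$ is contiguous to $Q_n$ if for every sequence of events $A_n\in\mathcal{F}_n$, $Q_n(A_n)\to0$ implies $P_n(A_n)\to0$ as $n\to\infty$. *)

theory Defs
  imports "HOL-Probability.Probability"
begin

text \<open>
  A random vector of size \<open>n\<close> is a point of the finite product space indexed by \<open>{..<n}\<close>, and an
  \<open>n \<times> n\<close> matrix is a point of the one indexed by \<open>{..<n} \<times> {..<n}\<close>; both are rendered as functions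
  that are \<open>undefined\<close> outside the index set.  Explicit index sets are needed since \<open>n\<close>
  varies within the statement.
\<close>

definition mat_space :: "nat \<Rightarrow> (nat \<times> nat \<Rightarrow> real) measure" where
  "mat_space n = PiM ({..<n} \<times> {..<n}) (\<lambda>_. borel)"

definition sparse_rademacher :: "real \<Rightarrow> real pmf" where
  "sparse_rademacher \<rho> =
     bind_pmf (bernoulli_pmf \<rho>)
       (\<lambda>b. if b then map_pmf (\<lambda>s. if s then 1 else - 1) (bernoulli_pmf (1 / 2)) else return_pmf 0)"

lemma pmf_sparse_rademacher:
  assumes "0 \<le> \<rho>" "\<rho> \<le> 1"
  shows "pmf (sparse_rademacher \<rho>) 0 = 1 - \<rho>"
    and "pmf (sparse_rademacher \<rho>) 1 = \<rho> / 2"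
    and "pmf (sparse_rademacher \<rho>) (- 1) = \<rho> / 2"
proof -
  have v: "(\<lambda>s. if s then 1 else - 1 :: real) -` {0} = {}"
    "(\<lambda>s. if s then 1 else - 1 :: real) -` {1} = {True}"
    "(\<lambda>s. if s then 1 else - 1 :: real) -` {- 1} = {False}"
    by (auto split: if_splits)
  have p: "measure (measure_pmf p) {x} = pmf p x" for p :: "bool pmf" and x
    by (simp add: pmf.rep_eq)
  show "pmf (sparse_rademacher \<rho>) 0 = 1 - \<rho>"
    and "pmf (sparse_rademacher \<rho>) 1 = \<rho> / 2"
    and "pmf (sparse_rademacher \<rho>) (- 1) = \<rho> / 2"
    using assms by (simp_all add: sparse_rademacher_def pmf_bind pmf_map v p)
qed

text \<open>The prior \<open>iid(\<pi>)\<close>; note the factor \<open>1 / sqrt n\<close> in each coordinate.\<close>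

definition iid_prior :: "real pmf \<Rightarrow> nat \<Rightarrow> (nat \<Rightarrow> real) measure" where
  "iid_prior \<pi> n = PiM {..<n} (\<lambda>_. distr (measure_pmf \<pi>) borel (\<lambda>z. 1 / sqrt (real n) * z))"

definition sparse_rademacher_prior :: "real \<Rightarrow> nat \<Rightarrow> (nat \<Rightarrow> real) measure" where
  "sparse_rademacher_prior \<rho> = iid_prior (map_pmf (\<lambda>r. sqrt (1 / \<rho>) * r) (sparse_rademacher \<rho>))"

text \<open>
  The upper triangle consists of independent Gaussians and is then reflected. The second parameter
  of \<open>normal_density\<close> is the standard deviation, hence \<open>sqrt 2\<close> for the diagonal variance \<open>2\<close>.
\<close>

definition GOE :: "nat \<Rightarrow> (nat \<times> nat \<Rightarrow> real) measure" where
  "GOE n = distr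
     (PiM {(i, j). i \<le> j \<and> j < n}
        (\<lambda>(i, j). density lborel (normal_density 0 (if i = j then sqrt 2 else 1))))
     (mat_space n)
     (\<lambda>g. \<lambda>(i, j)\<in>{..<n} \<times> {..<n}. g (min i j, max i j))"

definition GWig :: "nat \<Rightarrow> real \<Rightarrow> (nat \<Rightarrow> (nat \<Rightarrow> real) measure) \<Rightarrow> (nat \<times> nat \<Rightarrow> real) measure" where
  "GWig n lam X = distr (X n \<Otimes>\<^sub>M GOE n) (mat_space n)
     (\<lambda>(x, W). \<lambda>(i, j)\<in>{..<n} \<times> {..<n}. lam * (x i * x j) + 1 / sqrt (real n) * W (i, j))"

text \<open>\<open>P n\<close> and \<open>Q n\<close> are meant to be probability measures on the same measurable space.\<close>

definition contiguous :: "(nat \<Rightarrow> 'a measure) \<Rightarrow> (nat \<Rightarrow> 'a measure) \<Rightarrow> bool" where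
  "contiguous P Q \<longleftrightarrow>
     (\<forall>A. (\<forall>n. A n \<in> sets (Q n)) \<longrightarrow>
          (\<lambda>n. measure (Q n) (A n)) \<longlonglongrightarrow> 0 \<longrightarrow>
          (\<lambda>n. measure (P n) (A n)) \<longlonglongrightarrow> 0)"

definition sigma_star :: "real \<Rightarrow> real" where
  "sigma_star \<rho> = sqrt (SUP t\<in>UNIV - {0}.
     2 / t\<^sup>2 * ln ((1 - \<rho>\<^sup>2) + \<rho>\<^sup>2 / 2 * exp (t / \<rho>) + \<rho>\<^sup>2 / 2 * exp (- t / \<rho>)))"


text \<open>The distributions are well defined: all the maps involved are measurable.\<close>

lemma sets_GOE [measurable_cong]: "sets (GOE n) = sets (mat_space n)"
  by (simp add: GOE_def)

lemma sets_iid_prior [measurable_cong]: "sets (iid_prior \<pi> n) = sets (PiM {..<n} (\<lambda>_. borel))"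
  unfolding iid_prior_def by (intro sets_PiM_cong) auto

lemma prob_space_iid_prior: "prob_space (iid_prior \<pi> n)"
  unfolding iid_prior_def
  by (intro prob_space_PiM prob_space.prob_space_distr measure_pmf.prob_space_axioms) simp

lemma prob_space_GOE: "prob_space (GOE n)"
  unfolding GOE_def
proof (intro prob_space.prob_space_distr prob_space_PiM)
  fix p :: "nat \<times> nat"
  show "prob_space (case p of (i, j) \<Rightarrow>
          density lborel (normal_density 0 (if i = j then sqrt 2 else 1)))"
    by (cases p) (auto intro!: prob_space_normal_density)
next
  let ?T = "{(i, j). i \<le> j \<and> j < n}"
  let ?N = "\<lambda>(i, j). density lborel (normal_density 0 (if i = j then sqrt 2 else 1))"
  have s: "sets (PiM ?T ?N) = sets (PiM ?T (\<lambda>_. borel))"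
    by (intro sets_PiM_cong) auto
  have "(\<lambda>g. \<lambda>(i, j)\<in>{..<n} \<times> {..<n}. g (min i j, max i j))
      \<in> measurable (PiM ?T (\<lambda>_. borel :: real measure)) (PiM ({..<n} \<times> {..<n}) (\<lambda>_. borel))"
  proof (rule measurable_restrict)
    fix p assume "p \<in> {..<n} \<times> {..<n}"
    then show "(\<lambda>g. case p of (i, j) \<Rightarrow> g (min i j, max i j))
        \<in> borel_measurable (PiM ?T (\<lambda>_. borel :: real measure))"
      by (cases p) (auto intro!: measurable_component_singleton simp: min_def max_def)
  qed
  then show "(\<lambda>g. \<lambda>(i, j)\<in>{..<n} \<times> {..<n}. g (min i j, max i j))
      \<in> measurable (PiM ?T ?N) (mat_space n)"
    unfolding mat_space_def using measurable_cong_sets[OF s refl] by blast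
qed

lemma sets_GWig: "sets (GWig n lam X) = sets (mat_space n)"
  by (simp add: GWig_def)

lemma prob_space_GWig: "prob_space (GWig n lam (iid_prior \<pi>))"
  unfolding GWig_def
proof (intro prob_space.prob_space_distr)
  show "prob_space (iid_prior \<pi> n \<Otimes>\<^sub>M GOE n)"
    by (intro prob_space_pair prob_space_iid_prior prob_space_GOE)
  let ?M = "PiM {..<n} (\<lambda>_. borel :: real measure) \<Otimes>\<^sub>M PiM ({..<n} \<times> {..<n}) (\<lambda>_. borel :: real measure)"
  have s: "sets (iid_prior \<pi> n \<Otimes>\<^sub>M GOE n) = sets ?M"
    by (intro sets_pair_measure_cong sets_iid_prior) (simp add: sets_GOE mat_space_def)
  have "(\<lambda>z. \<lambda>p\<in>{..<n} \<times> {..<n}.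
           lam * (fst z (fst p) * fst z (snd p)) + 1 / sqrt (real n) * snd z p)
      \<in> measurable ?M (PiM ({..<n} \<times> {..<n}) (\<lambda>_. borel))"
  proof (rule measurable_restrict)
    fix p assume p: "p \<in> {..<n} \<times> {..<n}"
    have [measurable]: "(\<lambda>z. fst z i) \<in> borel_measurable ?M" if "i < n" for i
      using measurable_compose[OF measurable_fst measurable_component_singleton] that by simp
    have [measurable]: "(\<lambda>z. snd z p) \<in> borel_measurable ?M"
      using measurable_compose[OF measurable_snd measurable_component_singleton] p by simp
    show "(\<lambda>z. lam * (fst z (fst p) * fst z (snd p)) + 1 / sqrt (real n) * snd z p)
        \<in> borel_measurable ?M"
      using p by (intro borel_measurable_add borel_measurable_times) auto
  qed
  also have "(\<lambda>z. \<lambda>p\<in>{..<n} \<times> {..<n}.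
           lam * (fst z (fst p) * fst z (snd p)) + 1 / sqrt (real n) * snd z p) =
      (\<lambda>(x, W). \<lambda>(i, j)\<in>{..<n} \<times> {..<n}. lam * (x i * x j) + 1 / sqrt (real n) * W (i, j))"
    by (auto simp: fun_eq_iff restrict_def)
  finally show "(\<lambda>(x, W). \<lambda>(i, j)\<in>{..<n} \<times> {..<n}. lam * (x i * x j) + 1 / sqrt (real n) * W (i, j))
      \<in> measurable (iid_prior \<pi> n \<Otimes>\<^sub>M GOE n) (mat_space n)"
    unfolding mat_space_def using measurable_cong_sets[OF s refl] by blast
qed

text \<open>The supremum defining \<open>sigma_star\<close> is that of a bounded set of nonnegative reals.\<close>

lemma cosh_le_exp_square: "cosh (s :: real) \<le> exp (s\<^sup>2)"
proof -
  have *: "cosh s \<le> exp (s\<^sup>2)" if "s \<ge> 0" for s :: real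
  proof (cases "s \<le> 1")
    case True
    have a: "exp s \<le> 1 + s + s\<^sup>2"
      using exp_bound[of s] that True by simp
    have "(1 - s + s\<^sup>2) * (1 + s) = 1 + s ^ 3"
      by (simp add: algebra_simps power2_eq_square power3_eq_cube)
    then have "1 \<le> (1 - s + s\<^sup>2) * (1 + s)"
      using that by simp
    also have "\<dots> \<le> (1 - s + s\<^sup>2) * exp s"
      using True by (intro mult_left_mono exp_ge_add_one_self) auto
    finally have b: "exp (- s) \<le> 1 - s + s\<^sup>2"
      by (simp add: exp_minus field_simps)
    have "cosh s \<le> 1 + s\<^sup>2"
      using a b by (simp add: cosh_def)
    also have "\<dots> \<le> exp (s\<^sup>2)"
      by (rule exp_ge_add_one_self)
    finally show ?thesis .
  next
    case False
    then have "s \<le> s\<^sup>2"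
      by (simp add: power2_eq_square)
    then have "exp s \<le> exp (s\<^sup>2)"
      by simp
    moreover have "exp (- s) \<le> exp s"
      using that by simp
    moreover have "2 * cosh s = exp s + exp (- s)"
      by (simp add: cosh_def)
    ultimately show ?thesis
      by (smt (verit))
  qed
  show ?thesis
    using *[of s] *[of "- s"] by (cases "s \<ge> 0") auto
qed

lemma
  assumes "0 < \<rho>" "\<rho> \<le> 1"
  defines "F \<equiv> \<lambda>t :: real.
    2 / t\<^sup>2 * ln ((1 - \<rho>\<^sup>2) + \<rho>\<^sup>2 / 2 * exp (t / \<rho>) + \<rho>\<^sup>2 / 2 * exp (- t / \<rho>))"
  shows sigma_star_bdd_above: "bdd_above (F ` (UNIV - {0}))"
    and sigma_star_nonneg: "sigma_star \<rho> \<ge> 0"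
    and sigma_star_square: "(sigma_star \<rho>)\<^sup>2 = (SUP t\<in>UNIV - {0}. F t)"
proof -
  have r: "\<rho>\<^sup>2 \<le> 1"
    using assms by (simp add: power_le_one)
  have eq: "(1 - \<rho>\<^sup>2) + \<rho>\<^sup>2 / 2 * exp (t / \<rho>) + \<rho>\<^sup>2 / 2 * exp (- t / \<rho>) =
      (1 - \<rho>\<^sup>2) + \<rho>\<^sup>2 * cosh (t / \<rho>)" for t
    by (simp add: cosh_def field_simps)
  have ge1: "1 \<le> (1 - \<rho>\<^sup>2) + \<rho>\<^sup>2 * cosh (t / \<rho>)" for t
    using mult_left_mono[OF cosh_real_ge_1[of "t / \<rho>"], of "\<rho>\<^sup>2"] by simp
  have pos: "F t \<ge> 0" for t
    unfolding F_def eq using ge1[of t] by simp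
  have le: "F t \<le> 2 / \<rho>\<^sup>2" if "t \<noteq> 0" for t
  proof -
    have "0 \<le> (1 - \<rho>\<^sup>2) * (cosh (t / \<rho>) - 1)"
      using r cosh_real_ge_1[of "t / \<rho>"] by (intro mult_nonneg_nonneg) auto
    then have "(1 - \<rho>\<^sup>2) + \<rho>\<^sup>2 * cosh (t / \<rho>) \<le> cosh (t / \<rho>)"
      by (simp add: algebra_simps)
    also have "\<dots> \<le> exp ((t / \<rho>)\<^sup>2)"
      by (rule cosh_le_exp_square)
    finally have "ln ((1 - \<rho>\<^sup>2) + \<rho>\<^sup>2 * cosh (t / \<rho>)) \<le> (t / \<rho>)\<^sup>2"
      using ge1[of t] ln_mono[of "(1 - \<rho>\<^sup>2) + \<rho>\<^sup>2 * cosh (t / \<rho>)" "exp ((t / \<rho>)\<^sup>2)"]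
      by simp
    then have "F t \<le> 2 / t\<^sup>2 * (t / \<rho>)\<^sup>2"
      unfolding F_def eq by (intro mult_left_mono) auto
    also have "\<dots> = 2 / \<rho>\<^sup>2"
      using that by (simp add: power_divide)
    finally show ?thesis .
  qed
  show bdd: "bdd_above (F ` (UNIV - {0}))"
    using le by (intro bdd_aboveI2) auto
  have "0 \<le> F 1"
    by (rule pos)
  also have "\<dots> \<le> (SUP t\<in>UNIV - {0}. F t)"
    using bdd by (intro cSUP_upper) auto
  finally have n: "0 \<le> (SUP t\<in>UNIV - {0}. F t)" .
  have s: "sigma_star \<rho> = sqrt (SUP t\<in>UNIV - {0}. F t)"
    by (simp add: sigma_star_def F_def)
  show "sigma_star \<rho> \<ge> 0" "(sigma_star \<rho>)\<^sup>2 = (SUP t\<in>UNIV - {0}. F t)"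
    using n by (simp_all add: s)
qed

end

theory Submission
  imports Defs "HOL-Real_Asymp.Real_Asymp"
begin

text \<open>
  The quantity inside the logarithm is \<open>1 - \<rho>\<^sup>2 + \<rho>\<^sup>2 cosh (t / \<rho>)\<close>. Comparing its power series with that of
  \<open>exp (t\<^sup>2 / 2)\<close>, the coefficient of \<open>t ^ (2 k)\<close> is dominated for all \<open>k\<close> as soon as \<open>1 / \<rho>\<^sup>2 \<le> 3\<close>, whereas
  for \<open>1 / \<rho>\<^sup>2 > 3\<close> domination already fails at \<open>t ^ 4\<close>, for small \<open>t\<close>.

  For contiguity, it suffices to bound, uniformly in the dimension, the second
  moment of the likelihood ratio. By the Gaussian shift formula it equals the expectation of
  \<open>exp (n \<lambda>\<^sup>2 \<langle>x, x'\<rangle>\<^sup>2 / 2)\<close> over two independent copies of the prior. As \<open>\<surd>n \<langle>x, x'\<rangle>\<close> is subgaussian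
  with variance proxy \<open>1\<close>, averaging against an auxiliary standard Gaussian \<open>g\<close> bounds this by the
  expectation of \<open>exp (\<lambda>\<^sup>2 g\<^sup>2 / 2)\<close>, which is \<open>1 / sqrt (1 - \<lambda>\<^sup>2)\<close>.
\<close>

section \<open>The variance proxy\<close>

text \<open>Passing from \<open>k\<close> to \<open>Suc k\<close> multiplies the left side by
  \<open>r * (2 * k + 4)\<close> and the right side by \<open>(2 * k + 3) * (2 * k + 4)\<close>, so
  \<open>r \<le> 3\<close> is exactly what the step from \<open>k = 0\<close> asks for. With
  \<open>r = 1 / \<rho>^2\<close> this is the coefficient comparison behind
  \<open>sparse_cosh_le_exp\<close>; the constant coefficients agree there, hence the index
  shift.\<close>

lemma fact_double_ge:
  fixes r :: real
  assumes "0 \<le> r" "r \<le> 3"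
  shows "r ^ k * 2 ^ Suc k * fact (Suc k) \<le> fact (2 * Suc k)"
proof (induction k)
  case 0
  show ?case by simp
next
  case (Suc k)
  have "r ^ Suc k * 2 ^ Suc (Suc k) * fact (Suc (Suc k))
      = (r * (2 * real k + 4)) * (r ^ k * 2 ^ Suc k * fact (Suc k))"
    by (simp add: algebra_simps)
  also have "\<dots> \<le> ((2 * real k + 3) * (2 * real k + 4)) * fact (2 * Suc k)"
    using Suc assms by (intro mult_mono mult_right_mono) auto
  also have "\<dots> = fact (2 * Suc (Suc k))"
    by (simp add: algebra_simps)
  finally show ?case .
qed

lemma cosh_sums_even: "(\<lambda>k. x ^ (2 * k) / fact (2 * k)) sums cosh (x :: real)"
proof -
  have "(\<lambda>n. if even n then x ^ n /\<^sub>R fact n else 0) sums cosh x"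
    by (rule cosh_converges)
  then have "(\<lambda>k. (\<lambda>n. if even n then x ^ n /\<^sub>R fact n else 0) (2 * k)) sums cosh x"
    by (subst sums_mono_reindex[where g = "\<lambda>k. 2 * k"]) (auto simp: strict_mono_def elim!: evenE)
  then show ?thesis
    by (simp add: divide_inverse mult.commute)
qed

text \<open>Both sides have constant term 1, and the remaining coefficients are compared one by one
  through \<open>fact_double_ge\<close>. The bound serves twice: for
  \<open>sigma_star \<rho> \<le> 1\<close> and for the second moment.\<close>

lemma sparse_cosh_le_exp:
  fixes \<rho> t :: real
  assumes "1 / sqrt 3 \<le> \<rho>"
  shows "1 - \<rho>\<^sup>2 + \<rho>\<^sup>2 * cosh (t / \<rho>) \<le> exp (t\<^sup>2 / 2)"
proof -
  have \<rho>: "\<rho> > 0"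
    using assms by (smt (verit) divide_pos_pos real_sqrt_gt_0_iff)
  have "(1 / sqrt 3)\<^sup>2 \<le> \<rho>\<^sup>2"
    using assms by (intro power_mono) auto
  then have r: "1 / \<rho>\<^sup>2 \<le> 3"
    using \<rho> by (simp add: power_divide field_simps)
  let ?a = "\<lambda>k. \<rho>\<^sup>2 * ((t / \<rho>) ^ (2 * k) / fact (2 * k))"
  have "?a sums (\<rho>\<^sup>2 * cosh (t / \<rho>))"
    by (intro sums_mult cosh_sums_even)
  then have 1: "(\<lambda>k. ?a (Suc k)) sums (\<rho>\<^sup>2 * cosh (t / \<rho>) - \<rho>\<^sup>2)"
    by (subst sums_Suc_iff) simp
  have exp_sums: "(\<lambda>k. x ^ k / fact k) sums exp x" for x :: real
    using exp_converges[of x] by (simp add: divide_inverse_commute)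
  have "(\<lambda>k. (t\<^sup>2 / 2) ^ k / fact k) sums exp (t\<^sup>2 / 2)"
    by (rule exp_sums)
  then have 2: "(\<lambda>k. (t\<^sup>2 / 2) ^ Suc k / fact (Suc k)) sums (exp (t\<^sup>2 / 2) - 1)"
    by (subst sums_Suc_iff) simp
  have "?a (Suc k) \<le> (t\<^sup>2 / 2) ^ Suc k / fact (Suc k)" for k
  proof -
    have "\<rho>\<^sup>2 * (t / \<rho>) ^ (2 * Suc k) = (t\<^sup>2) ^ Suc k * (1 / \<rho>\<^sup>2) ^ k"
      using \<rho> by (simp only: power_mult power_divide power_Suc) (simp add: field_simps)
    then have "?a (Suc k) = (t\<^sup>2) ^ Suc k * ((1 / \<rho>\<^sup>2) ^ k / fact (2 * Suc k))"
      by (simp only: times_divide_eq_right)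
    also have "\<dots> \<le> (t\<^sup>2) ^ Suc k * (1 / (2 ^ Suc k * fact (Suc k)))"
    proof (rule mult_left_mono)
      show "(1 / \<rho>\<^sup>2) ^ k / fact (2 * Suc k) \<le> 1 / (2 ^ Suc k * fact (Suc k))"
        using fact_double_ge[of "1 / \<rho>\<^sup>2" k] r
        by (simp add: pos_divide_le_eq pos_le_divide_eq mult.assoc del: fact_Suc power_Suc)
    qed simp
    also have "\<dots> = (t\<^sup>2 / 2) ^ Suc k / fact (Suc k)"
      by (simp only: power_divide divide_divide_eq_left times_divide_eq_right mult_1_right)
    finally show ?thesis .
  qed
  then have "\<rho>\<^sup>2 * cosh (t / \<rho>) - \<rho>\<^sup>2 \<le> exp (t\<^sup>2 / 2) - 1"
    by (rule sums_le[OF _ 1 2])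
  then show ?thesis by simp
qed

section \<open>Lower bounds on the variance proxy from expansions at zero\<close>

lemma cosh_ge_quartic: "1 + x\<^sup>2 / 2 + x ^ 4 / 24 \<le> cosh (x :: real)"
proof -
  have "(\<Sum>k<3. x ^ (2 * k) / fact (2 * k)) \<le> cosh x"
    using cosh_sums_even[of x] sum_le_suminf[of "\<lambda>k. x ^ (2 * k) / fact (2 * k)" "{..<3}"]
    by (auto simp: sums_iff zero_le_even_power)
  then show ?thesis
    by (simp add: eval_nat_numeral)
qed

text \<open>A single nonzero \<open>t\<close> suffices, since \<open>sigma_star\<close> comes from a
  supremum that is bounded above. Keeping \<open>c\<close> free allows both values just below 1 and
  a value above 1.\<close>

lemma sigma_star_ge:
  assumes "0 < \<rho>" "\<rho> \<le> 1" "t \<noteq> 0" "exp (c * t\<^sup>2 / 2) \<le> 1 - \<rho>\<^sup>2 + \<rho>\<^sup>2 * cosh (t / \<rho>)"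
  shows "c \<le> (sigma_star \<rho>)\<^sup>2"
proof -
  let ?F = "\<lambda>t. 2 / t\<^sup>2 * ln ((1 - \<rho>\<^sup>2) + \<rho>\<^sup>2 / 2 * exp (t / \<rho>) + \<rho>\<^sup>2 / 2 * exp (- t / \<rho>))"
  have "c * t\<^sup>2 / 2 \<le> ln (1 - \<rho>\<^sup>2 + \<rho>\<^sup>2 * cosh (t / \<rho>))"
    using assms(4) by (subst ln_ge_iff) (auto intro: less_le_trans[OF exp_gt_zero])
  then have "c \<le> ?F t"
    using assms(3) by (simp add: cosh_def field_simps)
  also have "\<dots> \<le> (SUP t\<in>UNIV - {0}. ?F t)"
    using assms sigma_star_bdd_above[of \<rho>] by (intro cSUP_upper) auto
  finally show ?thesis
    using assms by (simp add: sigma_star_square)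
qed

text \<open>The quadratic terms of the moment generating function and of
  \<open>exp (t^2 / 2)\<close> agree. For \<open>c < 1\<close> the term \<open>c * t^2 / 2\<close>
  is strictly smaller, which decides the comparison for small \<open>t\<close>; then
  \<open>c\<close> tends to 1.\<close>

lemma sigma_star_ge_1:
  assumes "0 < \<rho>" "\<rho> \<le> 1"
  shows "1 \<le> sigma_star \<rho>"
proof -
  have "c \<le> (sigma_star \<rho>)\<^sup>2" if c: "0 < c" "c < 1" for c
  proof -
    have "eventually (\<lambda>t. exp (c * t\<^sup>2 / 2) < 1 + t\<^sup>2 / 2) (at_right 0)"
      using c by real_asymp
    then have "eventually (\<lambda>t. exp (c * t\<^sup>2 / 2) < 1 + t\<^sup>2 / 2 \<and> t > 0) (at_right 0)"
      by (intro eventually_conj eventually_at_right_less)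
    then obtain t where t: "exp (c * t\<^sup>2 / 2) < 1 + t\<^sup>2 / 2" "t > 0"
      using eventually_happens'[OF trivial_limit_at_right_real] by blast
    have "1 + (t / \<rho>)\<^sup>2 / 2 \<le> cosh (t / \<rho>)"
      using cosh_ge_quartic[of "t / \<rho>"] zero_le_even_power[of 4 "t / \<rho>"]
      by (smt (verit) divide_nonneg_nonneg even_numeral)
    then have "\<rho>\<^sup>2 * (1 + (t / \<rho>)\<^sup>2 / 2) \<le> \<rho>\<^sup>2 * cosh (t / \<rho>)"
      by (intro mult_left_mono) auto
    also have "\<rho>\<^sup>2 * (1 + (t / \<rho>)\<^sup>2 / 2) = \<rho>\<^sup>2 + t\<^sup>2 / 2"
      using assms by (simp add: field_simps power_divide)
    finally show ?thesis
      using t c assms by (intro sigma_star_ge[of \<rho> t]) auto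
  qed
  then have "1 \<le> (sigma_star \<rho>)\<^sup>2"
    by (intro dense_le_bounded[of 0 1]) auto
  then show ?thesis
    using sigma_star_nonneg[OF assms] power2_le_imp_le[of 1 "sigma_star \<rho>"] by simp
qed

lemma sigma_star_gt_1:
  assumes "0 < \<rho>" "\<rho> < 1 / sqrt 3"
  shows "1 < sigma_star \<rho>"
proof -
  have "\<rho>\<^sup>2 < (1 / sqrt 3)\<^sup>2"
    using assms by (intro power_strict_mono) auto
  then have r: "\<rho>\<^sup>2 < 1 / 3"
    by (simp add: power_divide)
  then have "\<rho>\<^sup>2 < 1\<^sup>2" by simp
  then have \<rho>1: "\<rho> \<le> 1"
    by (rule power2_less_imp_less[THEN less_imp_le]) simp
  \<comment> \<open>This is the coefficient of \<open>t ^ 4\<close> in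
    \<open>\<rho>^2 * cosh (t / \<rho>)\<close>. The one in \<open>exp (t^2 / 2)\<close> is
    \<open>1 / 8\<close>, and \<open>b > 1 / 8\<close> amounts to
    \<open>\<rho>^2 < 1 / 3\<close>.\<close>
  define b where "b = 1 / (24 * \<rho>\<^sup>2)"
  have b: "b > 1 / 8"
    using r assms by (simp add: b_def field_simps)
  have "\<exists>t>0. \<exists>c>1. exp (c * t\<^sup>2 / 2) \<le> 1 + t\<^sup>2 / 2 + b * t ^ 4"
  proof -
    have "eventually (\<lambda>t. exp (t\<^sup>2 / 2) < 1 + t\<^sup>2 / 2 + b * t ^ 4) (at_right 0)"
      using b by real_asymp
    then have "eventually (\<lambda>t. exp (t\<^sup>2 / 2) < 1 + t\<^sup>2 / 2 + b * t ^ 4 \<and> t > 0) (at_right 0)"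
      by (intro eventually_conj eventually_at_right_less)
    then obtain t where t: "exp (t\<^sup>2 / 2) < 1 + t\<^sup>2 / 2 + b * t ^ 4" "t > 0"
      using eventually_happens'[OF trivial_limit_at_right_real] by blast
    \<comment> \<open>The inequality at \<open>c = 1\<close> is strict, so with \<open>t\<close>
      fixed it survives for some \<open>c > 1\<close>. Such a \<open>c\<close> is needed for a
      strict bound on the supremum.\<close>
    have "((\<lambda>c. exp (c * t\<^sup>2 / 2)) \<longlongrightarrow> exp (1 * t\<^sup>2 / 2)) (at_right 1)"
      by (intro tendsto_intros) auto
    then have "eventually (\<lambda>c. exp (c * t\<^sup>2 / 2) < 1 + t\<^sup>2 / 2 + b * t ^ 4) (at_right 1)"
      using t by (intro order_tendstoD) auto
    then have "eventually (\<lambda>c. exp (c * t\<^sup>2 / 2) < 1 + t\<^sup>2 / 2 + b * t ^ 4 \<and> c > 1) (at_right 1)"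
      by (intro eventually_conj eventually_at_right_less)
    then obtain c where "exp (c * t\<^sup>2 / 2) < 1 + t\<^sup>2 / 2 + b * t ^ 4" "c > 1"
      using eventually_happens'[OF trivial_limit_at_right_real] by blast
    with t show ?thesis by (meson less_imp_le)
  qed
  then obtain t c where tc: "t > 0" "c > 1" "exp (c * t\<^sup>2 / 2) \<le> 1 + t\<^sup>2 / 2 + b * t ^ 4"
    by blast
  have "\<rho>\<^sup>2 * (1 + (t / \<rho>)\<^sup>2 / 2 + (t / \<rho>) ^ 4 / 24) \<le> \<rho>\<^sup>2 * cosh (t / \<rho>)"
    by (intro mult_left_mono cosh_ge_quartic) auto
  moreover have "\<rho>\<^sup>2 * (1 + (t / \<rho>)\<^sup>2 / 2 + (t / \<rho>) ^ 4 / 24) = \<rho>\<^sup>2 + t\<^sup>2 / 2 + b * t ^ 4"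
    using assms by (simp add: b_def field_simps power_divide eval_nat_numeral)
  ultimately have "c \<le> (sigma_star \<rho>)\<^sup>2"
    using tc assms \<rho>1 by (intro sigma_star_ge[of \<rho> t]) auto
  then have "1\<^sup>2 < (sigma_star \<rho>)\<^sup>2"
    using tc by simp
  then show ?thesis
    by (rule power2_less_imp_less) (use sigma_star_nonneg[of \<rho>] assms \<rho>1 in simp)
qed

lemma sigma_star_eq_1:
  assumes "1 / sqrt 3 \<le> \<rho>" "\<rho> \<le> 1"
  shows "sigma_star \<rho> = 1"
proof (rule antisym)
  have \<rho>: "0 < \<rho>"
    using assms by (smt (verit) divide_pos_pos real_sqrt_gt_0_iff)
  then show "1 \<le> sigma_star \<rho>"
    using assms by (intro sigma_star_ge_1)
  have "2 / t\<^sup>2 * ln ((1 - \<rho>\<^sup>2) + \<rho>\<^sup>2 / 2 * exp (t / \<rho>) + \<rho>\<^sup>2 / 2 * exp (- t / \<rho>)) \<le> 1"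
    if "t \<noteq> 0" for t
  proof -
    let ?u = "1 - \<rho>\<^sup>2 + \<rho>\<^sup>2 * cosh (t / \<rho>)"
    have "1 \<le> ?u"
      using mult_left_mono[OF cosh_real_ge_1[of "t / \<rho>"], of "\<rho>\<^sup>2"] by simp
    then have "ln ?u \<le> t\<^sup>2 / 2"
      using ln_mono[OF sparse_cosh_le_exp[OF assms(1), of t]] by simp
    then show ?thesis
      using that by (simp add: cosh_def field_simps)
  qed
  then have "(SUP t\<in>UNIV - {0}. 2 / t\<^sup>2 *
      ln ((1 - \<rho>\<^sup>2) + \<rho>\<^sup>2 / 2 * exp (t / \<rho>) + \<rho>\<^sup>2 / 2 * exp (- t / \<rho>))) \<le> 1"
    by (intro cSUP_least) (auto intro: exI[of _ 1])
  then show "sigma_star \<rho> \<le> 1"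
    by (simp add: sigma_star_def)
qed

section \<open>Shifts of Gaussian vectors\<close>

text \<open>A product measure is determined by its values on boxes, and on a box the integrand
  splits into one factor per coordinate. The assumption \<open>fin\<close> is made because
  \<open>f i\<close> may take the value infinity, so that sigma-finiteness is not inherited.\<close>

lemma (in product_sigma_finite) density_PiM:
  assumes I: "finite I" and f [measurable]: "\<And>i. i \<in> I \<Longrightarrow> f i \<in> borel_measurable (M i)"
    and fin: "product_sigma_finite (\<lambda>i. density (M i) (f i))"
  shows "density (PiM I M) (\<lambda>x. \<Prod>i\<in>I. f i (x i)) = PiM I (\<lambda>i. density (M i) (f i))"
proof (rule product_sigma_finite.PiM_eqI[OF fin I])
  show "sets (density (PiM I M) (\<lambda>x. \<Prod>i\<in>I. f i (x i))) = sets (PiM I (\<lambda>i. density (M i) (f i)))"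
    by (simp cong: sets_PiM_cong)
next
  fix A assume A: "\<And>i. i \<in> I \<Longrightarrow> A i \<in> sets (density (M i) (f i))"
  then have A' [measurable]: "\<And>i. i \<in> I \<Longrightarrow> A i \<in> sets (M i)" by simp
  have "emeasure (density (PiM I M) (\<lambda>x. \<Prod>i\<in>I. f i (x i))) (Pi\<^sub>E I A) =
      (\<integral>\<^sup>+x. (\<Prod>i\<in>I. f i (x i)) * indicator (Pi\<^sub>E I A) x \<partial>PiM I M)"
  proof (rule emeasure_density)
    show "(\<lambda>x. \<Prod>i\<in>I. f i (x i)) \<in> borel_measurable (PiM I M)"
    proof (rule borel_measurable_prod_ennreal)
      fix i assume "i \<in> I"
      then show "(\<lambda>x. f i (x i)) \<in> borel_measurable (PiM I M)"
        using measurable_compose[OF measurable_component_singleton[of i I M] f[of i]] by simp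
    qed
    show "Pi\<^sub>E I A \<in> sets (PiM I M)"
      using I A' by (rule sets_PiM_I_finite)
  qed
  also have "\<dots> = (\<integral>\<^sup>+x. (\<Prod>i\<in>I. f i (x i) * indicator (A i) (x i)) \<partial>PiM I M)"
  proof (rule nn_integral_cong)
    fix x assume "x \<in> space (PiM I M)"
    \<comment> \<open>Points of the product space are \<open>undefined\<close> off \<open>I\<close>,
      so membership in the box is decided by the coordinates in \<open>I\<close> alone.\<close>
    then have "x \<in> extensional I" by (auto simp: space_PiM PiE_def)
    then have "indicator (Pi\<^sub>E I A) x = (\<Prod>i\<in>I. indicator (A i) (x i) :: ennreal)"
      using I by (auto simp: indicator_def PiE_iff prod_zero_iff)
    then show "(\<Prod>i\<in>I. f i (x i)) * indicator (Pi\<^sub>E I A) x = (\<Prod>i\<in>I. f i (x i) * indicator (A i) (x i))"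
      by (simp add: prod.distrib)
  qed
  also have "\<dots> = (\<Prod>i\<in>I. emeasure (density (M i) (f i)) (A i))"
    using I by (subst product_nn_integral_prod) (auto simp: emeasure_density intro!: prod.cong)
  finally show "emeasure (density (PiM I M) (\<lambda>x. \<Prod>i\<in>I. f i (x i))) (Pi\<^sub>E I A) =
      (\<Prod>i\<in>I. emeasure (density (M i) (f i)) (A i))" .
qed

text \<open>Again boxes suffice: the preimage of a box under a coordinatewise map is the box of
  preimages. Images of sigma-finite measures need not be sigma-finite, hence
  \<open>fin\<close>.\<close>

lemma (in product_sigma_finite) distr_PiM_componentwise:
  assumes I: "finite I" and f [measurable]: "\<And>i. i \<in> I \<Longrightarrow> f i \<in> measurable (M i) (N i)"
    and fin: "product_sigma_finite (\<lambda>i. distr (M i) (N i) (f i))"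
  shows "distr (PiM I M) (PiM I N) (\<lambda>x. \<lambda>i\<in>I. f i (x i)) = PiM I (\<lambda>i. distr (M i) (N i) (f i))"
proof (rule product_sigma_finite.PiM_eqI[OF fin I])
  show "sets (distr (PiM I M) (PiM I N) (\<lambda>x. \<lambda>i\<in>I. f i (x i))) =
      sets (PiM I (\<lambda>i. distr (M i) (N i) (f i)))"
    by (simp cong: sets_PiM_cong)
next
  fix A assume A: "\<And>i. i \<in> I \<Longrightarrow> A i \<in> sets (distr (M i) (N i) (f i))"
  then have A' [measurable]: "\<And>i. i \<in> I \<Longrightarrow> A i \<in> sets (N i)" by simp
  have "emeasure (distr (PiM I M) (PiM I N) (\<lambda>x. \<lambda>i\<in>I. f i (x i))) (Pi\<^sub>E I A) =
      emeasure (PiM I M) ((\<lambda>x. \<lambda>i\<in>I. f i (x i)) -` Pi\<^sub>E I A \<inter> space (PiM I M))"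
  proof (rule emeasure_distr)
    show "(\<lambda>x. \<lambda>i\<in>I. f i (x i)) \<in> measurable (PiM I M) (PiM I N)"
    proof (rule measurable_restrict)
      fix i assume "i \<in> I"
      then show "(\<lambda>x. f i (x i)) \<in> measurable (PiM I M) (N i)"
        using measurable_compose[OF measurable_component_singleton[of i I M] f[of i]] by simp
    qed
    show "Pi\<^sub>E I A \<in> sets (PiM I N)"
      using I A' by (rule sets_PiM_I_finite)
  qed
  also have "(\<lambda>x. \<lambda>i\<in>I. f i (x i)) -` Pi\<^sub>E I A \<inter> space (PiM I M) =
      Pi\<^sub>E I (\<lambda>i. f i -` A i \<inter> space (M i))"
    by (auto simp: space_PiM PiE_iff)
  also have "emeasure (PiM I M) \<dots> = (\<Prod>i\<in>I. emeasure (distr (M i) (N i) (f i)) (A i))"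
    using I by (subst emeasure_PiM) (auto simp: emeasure_distr intro!: prod.cong)
  finally show "emeasure (distr (PiM I M) (PiM I N) (\<lambda>x. \<lambda>i\<in>I. f i (x i))) (Pi\<^sub>E I A) =
      (\<Prod>i\<in>I. emeasure (distr (M i) (N i) (f i)) (A i))" .
qed

text \<open>For \<open>s > 0\<close> this is the Radon-Nikodym derivative of the Gaussian with mean
  \<open>m\<close> and standard deviation \<open>s\<close> with respect to the centred one.\<close>

definition tilt :: "real \<Rightarrow> real \<Rightarrow> real \<Rightarrow> real" where
  "tilt s m z = exp ((m * z - m\<^sup>2 / 2) / s\<^sup>2)"

lemma tilt_0 [simp]: "tilt s 0 z = 1"
  by (simp add: tilt_def)

lemma tilt_nonneg [simp]: "0 \<le> tilt s m z"
  by (simp add: tilt_def)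

lemma borel_measurable_tilt [measurable (raw)]:
  assumes [measurable]: "f \<in> borel_measurable M" "g \<in> borel_measurable M"
  shows "(\<lambda>x. tilt s (f x) (g x)) \<in> borel_measurable M"
  unfolding tilt_def by measurable

text \<open>Expanding \<open>(m + m')^2\<close> leaves only the cross term \<open>m * m'\<close>.
  Since the remaining tilt integrates to one, correlations of likelihood ratios become explicit
  exponentials.\<close>

lemma tilt_mult: "tilt s m z * tilt s m' z = exp (m * m' / s\<^sup>2) * tilt s (m + m') z"
  by (simp add: tilt_def exp_add [symmetric] add_divide_distrib diff_divide_distrib power2_sum algebra_simps)

lemma normal_density_tilt:
  assumes "s > 0"
  shows "normal_density 0 s z * tilt s m z = normal_density m s z"
proof -
  have "- (z\<^sup>2) / (2 * s\<^sup>2) + (m * z - m\<^sup>2 / 2) / s\<^sup>2 = - ((z - m)\<^sup>2) / (2 * s\<^sup>2)"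
    using assms by (simp add: field_simps power2_diff)
  then show ?thesis
    by (simp add: normal_density_def tilt_def exp_add [symmetric])
qed

lemma density_tilt:
  assumes "s > 0"
  shows "density (density lborel (normal_density 0 s)) (\<lambda>z. ennreal (tilt s m z)) =
    density lborel (normal_density m s)"
  using assms by (subst density_density_eq) (auto simp: ennreal_mult'[symmetric] normal_density_tilt)

text \<open>This follows from translation invariance of Lebesgue measure.\<close>

lemma distr_normal_shift:
  assumes "s > 0"
  shows "distr (density lborel (normal_density 0 s)) borel (\<lambda>z. z + m) = density lborel (normal_density m s)"
proof -
  have "density lborel (normal_density m s) = density (distr lborel borel ((+) m)) (normal_density m s)"
    by (simp add: lborel_distr_plus)
  also have "\<dots> = distr (density lborel (\<lambda>z. normal_density m s (m + z))) borel ((+) m)"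
    by (subst density_distr) auto
  also have "(\<lambda>z. normal_density m s (m + z)) = normal_density 0 s"
    by (auto simp: normal_density_def)
  finally show ?thesis
    by (simp add: add.commute[of _ m])
qed

lemma nn_integral_tilt:
  assumes "s > 0"
  shows "(\<integral>\<^sup>+z. tilt s m z \<partial>density lborel (normal_density 0 s)) = 1"
proof -
  let ?N = "density lborel (normal_density 0 s)"
  have "(\<integral>\<^sup>+z. tilt s m z \<partial>?N) = emeasure (density ?N (\<lambda>z. ennreal (tilt s m z))) UNIV"
    by (subst emeasure_density) auto
  also have "\<dots> = 1"
    using prob_space.emeasure_space_1[OF prob_space_normal_density[OF assms, of m]]
    by (simp add: density_tilt[OF assms])
  finally show ?thesis .
qed

lemma nn_integral_tilt_mult:
  assumes "s > 0"
  shows "(\<integral>\<^sup>+z. ennreal (tilt s m z) * ennreal (tilt s m' z) \<partial>density lborel (normal_density 0 s)) =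
    ennreal (exp (m * m' / s\<^sup>2))"
proof -
  have "(\<integral>\<^sup>+z. ennreal (tilt s m z) * ennreal (tilt s m' z) \<partial>density lborel (normal_density 0 s)) =
    (\<integral>\<^sup>+z. ennreal (exp (m * m' / s\<^sup>2)) * ennreal (tilt s (m + m') z) \<partial>density lborel (normal_density 0 s))"
    by (simp add: ennreal_mult'[symmetric] tilt_mult)
  also have "\<dots> = ennreal (exp (m * m' / s\<^sup>2))"
    by (subst nn_integral_cmult) (auto simp: nn_integral_tilt[OF assms])
  finally show ?thesis .
qed

section \<open>Shifts and tilts of vectors of independent Gaussians\<close>

definition normal_vec :: "'i set \<Rightarrow> ('i \<Rightarrow> real) \<Rightarrow> ('i \<Rightarrow> real) measure" where
  "normal_vec I s = PiM I (\<lambda>i. density lborel (normal_density 0 (s i)))"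

lemma sets_normal_vec [measurable_cong]: "sets (normal_vec I s) = sets (PiM I (\<lambda>_. borel))"
  unfolding normal_vec_def by (intro sets_PiM_cong) auto

lemma product_sigma_finite_normal:
  "(\<And>i. s i > 0) \<Longrightarrow> product_sigma_finite (\<lambda>i. density lborel (normal_density (m i) (s i)))"
  by (simp add: product_sigma_finite_def prob_space_imp_sigma_finite prob_space_normal_density)

lemma prob_space_normal_vec: "(\<And>i. s i > 0) \<Longrightarrow> prob_space (normal_vec I s)"
  unfolding normal_vec_def by (intro prob_space_PiM prob_space_normal_density)

definition tilt_vec :: "'i set \<Rightarrow> ('i \<Rightarrow> real) \<Rightarrow> ('i \<Rightarrow> real) \<Rightarrow> ('i \<Rightarrow> real) \<Rightarrow> ennreal" where
  "tilt_vec I s m g = (\<Prod>i\<in>I. ennreal (tilt (s i) (m i) (g i)))"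

text \<open>Shifting and tilting give the same law in each coordinate, namely the Gaussian with mean
  \<open>m i\<close>. By independence the two product measures agree, so a shift of the argument may
  be traded for a weight.\<close>

lemma nn_integral_normal_vec_shift:
  assumes I: "finite I" and s: "\<And>i. s i > 0"
    and [measurable]: "f \<in> borel_measurable (PiM I (\<lambda>_. borel))"
  shows "(\<integral>\<^sup>+g. f (\<lambda>i\<in>I. g i + m i) \<partial>normal_vec I s) = (\<integral>\<^sup>+g. tilt_vec I s m g * f g \<partial>normal_vec I s)"
proof -
  let ?N = "\<lambda>m i. density lborel (normal_density m (s i))"
  interpret product_sigma_finite "\<lambda>i. ?N 0 i"
    by (rule product_sigma_finite_normal) (rule s)
  have eq: "distr (normal_vec I s) (PiM I (\<lambda>_. borel)) (\<lambda>g. \<lambda>i\<in>I. g i + m i) =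
      density (normal_vec I s) (tilt_vec I s m)"
  proof -
    have "distr (normal_vec I s) (PiM I (\<lambda>_. borel)) (\<lambda>g. \<lambda>i\<in>I. g i + m i) =
        PiM I (\<lambda>i. distr (?N 0 i) borel (\<lambda>z. z + m i))"
      unfolding normal_vec_def
      by (rule distr_PiM_componentwise)
        (auto simp: I distr_normal_shift[OF s] intro: product_sigma_finite_normal s)
    also have "\<dots> = PiM I (\<lambda>i. density (?N 0 i) (\<lambda>z. ennreal (tilt (s i) (m i) z)))"
      by (simp add: distr_normal_shift[OF s] density_tilt[OF s])
    also have "\<dots> = density (normal_vec I s) (tilt_vec I s m)"
      unfolding normal_vec_def tilt_vec_def
      by (rule density_PiM[symmetric])
        (auto simp: I density_tilt[OF s] intro: product_sigma_finite_normal s)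
    finally show ?thesis .
  qed
  have [measurable]: "tilt_vec I s m \<in> borel_measurable (normal_vec I s)"
    unfolding tilt_vec_def by measurable
  have "(\<integral>\<^sup>+g. f (\<lambda>i\<in>I. g i + m i) \<partial>normal_vec I s) =
      (\<integral>\<^sup>+g. f g \<partial>distr (normal_vec I s) (PiM I (\<lambda>_. borel)) (\<lambda>g. \<lambda>i\<in>I. g i + m i))"
    by (subst nn_integral_distr) auto
  also have "\<dots> = (\<integral>\<^sup>+g. tilt_vec I s m g * f g \<partial>normal_vec I s)"
    unfolding eq by (subst nn_integral_density) auto
  finally show ?thesis .
qed

lemma nn_integral_tilt_vec_mult:
  assumes I: "finite I" and s: "\<And>i. s i > 0"
  shows "(\<integral>\<^sup>+g. tilt_vec I s m g * tilt_vec I s m' g \<partial>normal_vec I s) =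
    ennreal (exp (\<Sum>i\<in>I. m i * m' i / (s i)\<^sup>2))"
proof -
  interpret product_sigma_finite "\<lambda>i. density lborel (normal_density 0 (s i))"
    by (rule product_sigma_finite_normal) (rule s)
  show ?thesis
    unfolding normal_vec_def tilt_vec_def prod.distrib[symmetric]
    using I by (subst product_nn_integral_prod)
      (auto simp: nn_integral_tilt_mult[OF s] prod_ennreal exp_sum)
qed

section \<open>The likelihood ratio of the spiked model\<close>

definition upper :: "nat \<Rightarrow> (nat \<times> nat) set" where
  "upper n = {(i, j). i \<le> j \<and> j < n}"

definition goe_sd :: "nat \<times> nat \<Rightarrow> real" where
  "goe_sd p = (if fst p = snd p then sqrt 2 else 1)"

abbreviation upper_normal :: "nat \<Rightarrow> (nat \<times> nat \<Rightarrow> real) measure" where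
  "upper_normal n \<equiv> normal_vec (upper n) goe_sd"

definition rescaled_reflection :: "nat \<Rightarrow> (nat \<times> nat \<Rightarrow> real) \<Rightarrow> nat \<times> nat \<Rightarrow> real" where
  "rescaled_reflection n g = (\<lambda>(i, j)\<in>{..<n} \<times> {..<n}. 1 / sqrt (real n) * g (min i j, max i j))"

text \<open>The mean shift is expressed before the noise is rescaled: the factor
  \<open>sqrt n\<close> compensates the later \<open>1 / sqrt n\<close> of
  \<open>rescaled_reflection\<close>.\<close>

definition spike :: "nat \<Rightarrow> real \<Rightarrow> (nat \<Rightarrow> real) \<Rightarrow> nat \<times> nat \<Rightarrow> real" where
  "spike n lam x p = sqrt (real n) * lam * (x (fst p) * x (snd p))"

text \<open>The likelihood ratio is taken on the unscaled upper triangle, where the entries are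
  independent, instead of on the symmetric matrix, whose entries repeat. Averaging over the prior
  reflects that the spiked law is a mixture over \<open>x\<close>.\<close>

definition likelihood :: "nat \<Rightarrow> real \<Rightarrow> real pmf \<Rightarrow> (nat \<times> nat \<Rightarrow> real) \<Rightarrow> ennreal" where
  "likelihood n lam \<pi> g = (\<integral>\<^sup>+x. tilt_vec (upper n) goe_sd (spike n lam x) g \<partial>iid_prior \<pi> n)"

lemma goe_sd_pos: "goe_sd p > 0"
  by (simp add: goe_sd_def)

lemma finite_upper: "finite (upper n)"
  by (rule finite_subset[of _ "{..<n} \<times> {..<n}"]) (auto simp: upper_def)

lemma min_max_in_upper: "i < n \<Longrightarrow> j < n \<Longrightarrow> (min i j, max i j) \<in> upper n"
  by (auto simp: upper_def min_def max_def)

lemma upper_Suc: "upper (Suc n) = upper n \<union> (\<lambda>i. (i, n)) ` {..n}"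
  by (auto simp: upper_def)

text \<open>The off-diagonal part contributes each product \<open>a i * a j\<close> with
  \<open>i < j\<close> once, and the diagonal variance 2 of the GOE turns \<open>(a i)^2\<close>
  into half of it. Together they form half of a perfect square. The induction adds the last
  column.\<close>

lemma sum_upper:
  "(\<Sum>p\<in>upper n. a (fst p) * a (snd p) / (goe_sd p)\<^sup>2) = (\<Sum>i<n. a i)\<^sup>2 / 2"
proof (induction n)
  case 0
  show ?case by (simp add: upper_def)
next
  case (Suc n)
  have "(\<Sum>p\<in>(\<lambda>i. (i, n)) ` {..n}. a (fst p) * a (snd p) / (goe_sd p)\<^sup>2) =
      (\<Sum>i\<le>n. a i * a n / (goe_sd (i, n))\<^sup>2)"
    by (subst sum.reindex) (auto simp: inj_on_def)
  also have "\<dots> = (\<Sum>i<n. a i * a n / (goe_sd (i, n))\<^sup>2) + (a n)\<^sup>2 / 2"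
    by (simp add: lessThan_Suc_atMost[symmetric] goe_sd_def power2_eq_square)
  also have "(\<Sum>i<n. a i * a n / (goe_sd (i, n))\<^sup>2) = (\<Sum>i<n. a i) * a n"
    by (simp add: goe_sd_def sum_distrib_right)
  finally show ?case
    unfolding upper_Suc
    by (subst sum.union_disjoint)
      (auto simp: Suc finite_upper power2_sum field_simps, auto simp: upper_def)
qed

lemma GOE_eq_distr: "GOE n = distr (upper_normal n) (mat_space n)
    (\<lambda>g. \<lambda>(i, j)\<in>{..<n} \<times> {..<n}. g (min i j, max i j))"
proof -
  have "(\<lambda>(i, j). density lborel (normal_density 0 (if i = j then sqrt 2 else 1))) =
      (\<lambda>p. density lborel (normal_density 0 (goe_sd p)))"
    by (auto simp: goe_sd_def fun_eq_iff)
  then show ?thesis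
    by (simp add: GOE_def normal_vec_def upper_def)
qed

lemma measurable_reflection:
  "(\<lambda>g. \<lambda>(i, j)\<in>{..<n} \<times> {..<n}. g (min i j, max i j)) \<in> measurable (upper_normal n) (mat_space n)"
  unfolding mat_space_def measurable_cong_sets[OF sets_normal_vec refl]
  by (rule measurable_restrict)
    (auto intro!: measurable_component_singleton min_max_in_upper)

lemma measurable_rescaled_reflection:
  "rescaled_reflection n \<in> measurable (PiM (upper n) (\<lambda>_. borel)) (mat_space n)"
  unfolding mat_space_def rescaled_reflection_def [abs_def]
  by (rule measurable_restrict)
    (auto intro!: borel_measurable_divide measurable_component_singleton min_max_in_upper)

lemma measurable_prior_component:
  "i < n \<Longrightarrow> (\<lambda>x. x i) \<in> borel_measurable (iid_prior \<pi> n)"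
  unfolding measurable_cong_sets[OF sets_iid_prior refl]
  by (rule measurable_component_singleton) simp

lemma measurable_GWig_map:
  "(\<lambda>(x, W). \<lambda>(i, j)\<in>{..<n} \<times> {..<n}. lam * (x i * x j) + 1 / sqrt (real n) * W (i, j))
    \<in> measurable (iid_prior \<pi> n \<Otimes>\<^sub>M GOE n) (mat_space n)"
proof -
  let ?M = "iid_prior \<pi> n \<Otimes>\<^sub>M GOE n"
  have "(\<lambda>z. \<lambda>p\<in>{..<n} \<times> {..<n}.
           lam * (fst z (fst p) * fst z (snd p)) + 1 / sqrt (real n) * snd z p)
      \<in> measurable ?M (PiM ({..<n} \<times> {..<n}) (\<lambda>_. borel))"
  proof (rule measurable_restrict)
    fix p assume p: "p \<in> {..<n} \<times> {..<n}"
    have [measurable]: "(\<lambda>z. fst z i) \<in> borel_measurable ?M" if "i < n" for i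
      using measurable_compose[OF measurable_fst measurable_prior_component[OF that]] .
    have "(\<lambda>W. W p) \<in> borel_measurable (GOE n)"
      unfolding measurable_cong_sets[OF sets_GOE refl] mat_space_def
      using p by (rule measurable_component_singleton)
    from measurable_compose[OF measurable_snd this]
    have [measurable]: "(\<lambda>z. snd z p) \<in> borel_measurable ?M" .
    show "(\<lambda>z. lam * (fst z (fst p) * fst z (snd p)) + 1 / sqrt (real n) * snd z p)
        \<in> borel_measurable ?M"
      using p by (intro borel_measurable_add borel_measurable_times) auto
  qed
  also have "(\<lambda>z. \<lambda>p\<in>{..<n} \<times> {..<n}.
           lam * (fst z (fst p) * fst z (snd p)) + 1 / sqrt (real n) * snd z p) =
      (\<lambda>(x, W). \<lambda>(i, j)\<in>{..<n} \<times> {..<n}. lam * (x i * x j) + 1 / sqrt (real n) * W (i, j))"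
    by (auto simp: fun_eq_iff restrict_def)
  finally show ?thesis
    by (simp add: mat_space_def)
qed

lemma measurable_tilt_vec_spike:
  "(\<lambda>z. tilt_vec (upper n) goe_sd (spike n lam (fst z)) (snd z))
    \<in> borel_measurable (iid_prior \<pi> n \<Otimes>\<^sub>M upper_normal n)"
  unfolding tilt_vec_def
proof (rule borel_measurable_prod_ennreal)
  fix p assume p: "p \<in> upper n"
  let ?M = "iid_prior \<pi> n \<Otimes>\<^sub>M upper_normal n"
  have [measurable]: "(\<lambda>z. fst z i) \<in> borel_measurable ?M" if "i < n" for i
    using measurable_compose[OF measurable_fst measurable_prior_component[OF that]] .
  have "(\<lambda>g. g p) \<in> borel_measurable (upper_normal n)"
    unfolding measurable_cong_sets[OF sets_normal_vec refl]
    using p by (rule measurable_component_singleton)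
  from measurable_compose[OF measurable_snd this]
  have [measurable]: "(\<lambda>z. snd z p) \<in> borel_measurable ?M" .
  have [simp]: "fst p < n" "snd p < n"
    using p by (auto simp: upper_def)
  show "(\<lambda>z. ennreal (tilt (goe_sd p) (spike n lam (fst z) p) (snd z p))) \<in> borel_measurable ?M"
    unfolding spike_def by measurable
qed

text \<open>For fixed \<open>x\<close> the observed matrix is a function of a shifted Gaussian
  vector. The shift formula turns the shift into a weight, and Tonelli's theorem averages the weight
  over the prior.\<close>

lemma emeasure_GWig:
  assumes n: "n > 0" and A: "A \<in> sets (mat_space n)"
  shows "emeasure (GWig n lam (iid_prior \<pi>)) A =
    (\<integral>\<^sup>+g. likelihood n lam \<pi> g * indicator A (rescaled_reflection n g) \<partial>upper_normal n)"
proof -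
  let ?X = "iid_prior \<pi> n" and ?G = "upper_normal n"
  let ?\<phi> = "\<lambda>(x, W). \<lambda>(i, j)\<in>{..<n} \<times> {..<n}. lam * (x i * x j) + 1 / sqrt (real n) * W (i, j)"
  let ?r = "\<lambda>g. \<lambda>(i, j)\<in>{..<n} \<times> {..<n}. g (min i j, max i j) :: real"
  let ?t = "\<lambda>x. tilt_vec (upper n) goe_sd (spike n lam x)"
  interpret X: prob_space ?X by (rule prob_space_iid_prior)
  interpret W: prob_space "GOE n" by (rule prob_space_GOE)
  interpret G: prob_space ?G by (rule prob_space_normal_vec) (rule goe_sd_pos)
  interpret XG: pair_sigma_finite ?X ?G ..
  note [measurable] = measurable_GWig_map A
  have ind_A: "(indicator A :: _ \<Rightarrow> ennreal) \<in> borel_measurable (mat_space n)"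
    by measurable
  have ind: "(\<lambda>g. indicator A (rescaled_reflection n g) :: ennreal)
      \<in> borel_measurable (PiM (upper n) (\<lambda>_. borel))"
    by (rule measurable_compose[OF measurable_rescaled_reflection]) measurable
  then have [measurable]: "(\<lambda>g. indicator A (rescaled_reflection n g) :: ennreal) \<in> borel_measurable ?G"
    unfolding measurable_cong_sets[OF sets_normal_vec refl] .
  have ind_\<phi>: "(\<lambda>z. indicator A (?\<phi> z) :: ennreal) \<in> borel_measurable (?X \<Otimes>\<^sub>M GOE n)"
    by (rule measurable_compose[OF measurable_GWig_map]) measurable
  have "emeasure (GWig n lam (iid_prior \<pi>)) A = (\<integral>\<^sup>+Y. indicator A Y \<partial>GWig n lam (iid_prior \<pi>))"
    by (simp add: A sets_GWig)
  also have "\<dots> = (\<integral>\<^sup>+z. indicator A (?\<phi> z) \<partial>(?X \<Otimes>\<^sub>M GOE n))"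
    unfolding GWig_def by (rule nn_integral_distr[OF measurable_GWig_map]) measurable
  also have "\<dots> = (\<integral>\<^sup>+x. \<integral>\<^sup>+W. indicator A (?\<phi> (x, W)) \<partial>GOE n \<partial>?X)"
    by (rule W.nn_integral_fst[OF ind_\<phi>, symmetric])
  also have "\<dots> = (\<integral>\<^sup>+x. \<integral>\<^sup>+g. ?t x g * indicator A (rescaled_reflection n g) \<partial>?G \<partial>?X)"
  proof (rule nn_integral_cong)
    fix x assume x: "x \<in> space ?X"
    have "(\<lambda>W. (x, W)) \<in> measurable (GOE n) (?X \<Otimes>\<^sub>M GOE n)"
      using x by (rule measurable_Pair1')
    from measurable_compose[OF this measurable_GWig_map]
    have m: "(\<lambda>W. ?\<phi> (x, W)) \<in> measurable (mat_space n) (mat_space n)"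
      unfolding measurable_cong_sets[OF sets_GOE refl] .
    have "(\<integral>\<^sup>+W. indicator A (?\<phi> (x, W)) \<partial>GOE n) = (\<integral>\<^sup>+g. indicator A (?\<phi> (x, ?r g)) \<partial>?G)"
      unfolding GOE_eq_distr
      by (rule nn_integral_distr[OF measurable_reflection])
        (simp only: measurable_distr_eq1 measurable_compose[OF m ind_A])
    also have "\<dots> = (\<integral>\<^sup>+g. indicator A (rescaled_reflection n (\<lambda>p\<in>upper n. g p + spike n lam x p)) \<partial>?G)"
    proof -
      \<comment> \<open>The spike is symmetric in its two indices, so adding it before or after the
        reflection is the same. Positivity of \<open>n\<close> lets \<open>sqrt n\<close> cancel,
        and the restriction to \<open>upper n\<close> is harmless since
        \<open>(min i j, max i j)\<close> lies there.\<close>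
      have "?\<phi> (x, ?r g) = rescaled_reflection n (\<lambda>p\<in>upper n. g p + spike n lam x p)" for g
        using n by (auto simp: rescaled_reflection_def fun_eq_iff restrict_def upper_def
            spike_def field_simps min_def max_def)
      then show ?thesis by simp
    qed
    also have "\<dots> = (\<integral>\<^sup>+g. ?t x g * indicator A (rescaled_reflection n g) \<partial>?G)"
      by (rule nn_integral_normal_vec_shift[OF finite_upper goe_sd_pos ind])
    finally show "(\<integral>\<^sup>+W. indicator A (?\<phi> (x, W)) \<partial>GOE n) = \<dots>" .
  qed
  also have "\<dots> = (\<integral>\<^sup>+g. \<integral>\<^sup>+x. ?t x g * indicator A (rescaled_reflection n g) \<partial>?X \<partial>?G)"
  proof (rule XG.Fubini'[symmetric])
    note [measurable] = measurable_tilt_vec_spike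
    have "(\<lambda>z. ?t (fst z) (snd z) * indicator A (rescaled_reflection n (snd z)))
        \<in> borel_measurable (?X \<Otimes>\<^sub>M ?G)"
      by measurable
    then show "(\<lambda>(x, g). ?t x g * indicator A (rescaled_reflection n g)) \<in> borel_measurable (?X \<Otimes>\<^sub>M ?G)"
      by (simp add: case_prod_unfold)
  qed
  also have "\<dots> = (\<integral>\<^sup>+g. likelihood n lam \<pi> g * indicator A (rescaled_reflection n g) \<partial>?G)"
  proof (rule nn_integral_cong)
    fix g assume g: "g \<in> space ?G"
    have "(\<lambda>x. (x, g)) \<in> measurable ?X (?X \<Otimes>\<^sub>M ?G)"
      using g by (rule measurable_Pair2')
    from measurable_compose[OF this measurable_tilt_vec_spike]
    have "(\<lambda>x. ?t x g) \<in> borel_measurable ?X" by simp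
    then show "(\<integral>\<^sup>+x. ?t x g * indicator A (rescaled_reflection n g) \<partial>?X) =
        likelihood n lam \<pi> g * indicator A (rescaled_reflection n g)"
      unfolding likelihood_def by (rule nn_integral_multc)
  qed
  finally show ?thesis .
qed

text \<open>Without a signal the shift is zero. Thus \<open>emeasure_GWig\<close> also describes the
  null model, on the same Gaussian space as the spiked one.\<close>

lemma likelihood_0: "likelihood n 0 \<pi> g = 1"
  using prob_space.emeasure_space_1[OF prob_space_iid_prior]
  by (simp add: likelihood_def tilt_vec_def spike_def)

lemma borel_measurable_likelihood: "likelihood n lam \<pi> \<in> borel_measurable (upper_normal n)"
proof -
  interpret X: prob_space "iid_prior \<pi> n" by (rule prob_space_iid_prior)
  interpret G: prob_space "upper_normal n" by (rule prob_space_normal_vec) (rule goe_sd_pos)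
  interpret XG: pair_sigma_finite "iid_prior \<pi> n" "upper_normal n" ..
  show ?thesis
    unfolding likelihood_def[abs_def]
    using X.borel_measurable_nn_integral_fst[OF measurable_pair_swap[OF measurable_tilt_vec_spike]]
    by simp
qed

text \<open>The square of an average over the prior is a double average over two independent copies.
  Integrating out the Gaussian first leaves the exponential of a weighted inner product of the two
  spikes, which \<open>sum_upper\<close> evaluates.\<close>

lemma second_moment_likelihood:
  "(\<integral>\<^sup>+g. likelihood n lam \<pi> g * likelihood n lam \<pi> g \<partial>upper_normal n) =
   (\<integral>\<^sup>+x. \<integral>\<^sup>+x'. ennreal (exp ((sqrt (real n) * lam * (\<Sum>i<n. x i * x' i))\<^sup>2 / 2))
      \<partial>iid_prior \<pi> n \<partial>iid_prior \<pi> n)"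
proof -
  let ?X = "iid_prior \<pi> n" and ?G = "upper_normal n"
  let ?t = "\<lambda>x. tilt_vec (upper n) goe_sd (spike n lam x)"
  interpret X: prob_space ?X by (rule prob_space_iid_prior)
  interpret G: prob_space ?G by (rule prob_space_normal_vec) (rule goe_sd_pos)
  interpret XG: pair_sigma_finite ?X ?G ..
  note [measurable] = borel_measurable_likelihood
  have t1 [measurable]: "?t x \<in> borel_measurable ?G" if "x \<in> space ?X" for x
    using measurable_compose[OF measurable_Pair1'[OF that] measurable_tilt_vec_spike[of n lam \<pi>]] by simp
  have t2 [measurable]: "(\<lambda>x. ?t x g) \<in> borel_measurable ?X" if "g \<in> space ?G" for g
    using measurable_compose[OF measurable_Pair2'[OF that] measurable_tilt_vec_spike[of n lam \<pi>]] by simp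
  \<comment> \<open>Used twice: with \<open>h\<close> the likelihood itself, which brings in the
    first copy \<open>x\<close>, and then with \<open>h\<close> the tilt at \<open>x\<close>, which
    brings in the second.\<close>
  have swap: "(\<integral>\<^sup>+g. h g * likelihood n lam \<pi> g \<partial>?G) = (\<integral>\<^sup>+x. \<integral>\<^sup>+g. h g * ?t x g \<partial>?G \<partial>?X)"
    if [measurable]: "h \<in> borel_measurable ?G" for h
  proof -
    have "(\<integral>\<^sup>+g. h g * likelihood n lam \<pi> g \<partial>?G) = (\<integral>\<^sup>+g. \<integral>\<^sup>+x. h g * ?t x g \<partial>?X \<partial>?G)"
      unfolding likelihood_def by (intro nn_integral_cong nn_integral_cmult[symmetric] t2)
    also have "\<dots> = (\<integral>\<^sup>+x. \<integral>\<^sup>+g. h g * ?t x g \<partial>?G \<partial>?X)"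
    proof (rule XG.Fubini')
      note [measurable] = measurable_tilt_vec_spike
      have "(\<lambda>z. h (snd z) * ?t (fst z) (snd z)) \<in> borel_measurable (?X \<Otimes>\<^sub>M ?G)"
        by measurable
      then show "(\<lambda>(x, g). h g * ?t x g) \<in> borel_measurable (?X \<Otimes>\<^sub>M ?G)"
        by (simp add: case_prod_unfold)
    qed
    finally show ?thesis .
  qed
  have "(\<integral>\<^sup>+g. likelihood n lam \<pi> g * likelihood n lam \<pi> g \<partial>?G) =
      (\<integral>\<^sup>+x. \<integral>\<^sup>+g. ?t x g * likelihood n lam \<pi> g \<partial>?G \<partial>?X)"
    by (subst swap) (simp_all add: mult.commute)
  also have "\<dots> = (\<integral>\<^sup>+x. \<integral>\<^sup>+x'. \<integral>\<^sup>+g. ?t x g * ?t x' g \<partial>?G \<partial>?X \<partial>?X)"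
    by (intro nn_integral_cong swap t1)
  also have "\<dots> = (\<integral>\<^sup>+x. \<integral>\<^sup>+x'. ennreal (exp ((sqrt (real n) * lam * (\<Sum>i<n. x i * x' i))\<^sup>2 / 2)) \<partial>?X \<partial>?X)"
  proof -
    have eq: "(\<Sum>p\<in>upper n. spike n lam x p * spike n lam x' p / (goe_sd p)\<^sup>2) =
        (sqrt (real n) * lam * (\<Sum>i<n. x i * x' i))\<^sup>2 / 2" for x x'
    proof -
      let ?c = "(sqrt (real n) * lam)\<^sup>2"
      have eq: "(\<Sum>p\<in>upper n. spike n lam x p * spike n lam x' p / (goe_sd p)\<^sup>2) =
          (\<Sum>p\<in>upper n. ?c * ((x (fst p) * x' (fst p)) * (x (snd p) * x' (snd p)) / (goe_sd p)\<^sup>2))"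
        by (intro sum.cong refl) (simp add: spike_def power2_eq_square mult_ac)
      \<comment> \<open>Here \<open>sum_upper\<close> is applied to the coordinatewise products
        \<open>x i * x' i\<close>.\<close>
      also have "\<dots> = ?c * ((\<Sum>i<n. x i * x' i)\<^sup>2 / 2)"
        unfolding sum_distrib_left[symmetric] by (subst sum_upper) (rule refl)
      finally show ?thesis by (simp add: power_mult_distrib)
    qed
    show ?thesis
      by (simp only: nn_integral_tilt_vec_mult[OF finite_upper goe_sd_pos] eq)
  qed
  finally show ?thesis .
qed

text \<open>Where the likelihood ratio exceeds \<open>K\<close>, it is at most its square over \<open>K\<close>.\<close>

lemma emeasure_GWig_le:
  assumes n: "n > 0" and A: "A \<in> sets (mat_space n)" and K: "K > 0"
    and C: "(\<integral>\<^sup>+g. likelihood n lam \<pi> g * likelihood n lam \<pi> g \<partial>upper_normal n) \<le> ennreal C"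
  shows "emeasure (GWig n lam (iid_prior \<pi>)) A \<le>
    ennreal K * emeasure (GWig n 0 (iid_prior \<pi>)) A + ennreal (1 / K) * ennreal C"
proof -
  let ?I = "\<lambda>g. indicator A (rescaled_reflection n g) :: ennreal"
  let ?L = "likelihood n lam \<pi>"
  have [measurable]: "?I \<in> borel_measurable (upper_normal n)"
    unfolding measurable_cong_sets[OF sets_normal_vec refl]
    by (rule measurable_compose[OF measurable_rescaled_reflection]) (use A in measurable)
  note [measurable] = borel_measurable_likelihood
  have le: "?L g * ?I g \<le> ennreal K * ?I g + ennreal (1 / K) * (?L g * ?L g)" for g
  proof (cases "?L g \<le> ennreal K")
    case True
    then have "?L g * ?I g \<le> ennreal K * ?I g"
      by (intro mult_right_mono) auto
    then show ?thesis
      by (rule order_trans) simp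
  next
    case False
    have "?L g = ennreal (1 / K) * ennreal K * ?L g"
      using K by (simp add: ennreal_mult'[symmetric])
    also have "\<dots> \<le> ennreal (1 / K) * (?L g * ?L g)"
      unfolding mult.assoc using False by (intro mult_left_mono mult_right_mono) auto
    finally have "?L g \<le> ennreal (1 / K) * (?L g * ?L g)" .
    moreover have "?L g * ?I g \<le> ?L g"
      by (auto simp: indicator_def)
    ultimately show ?thesis
      by (meson add_increasing order_trans zero_le)
  qed
  have "emeasure (GWig n lam (iid_prior \<pi>)) A = (\<integral>\<^sup>+g. ?L g * ?I g \<partial>upper_normal n)"
    by (rule emeasure_GWig[OF n A])
  also have "\<dots> \<le> (\<integral>\<^sup>+g. ennreal K * ?I g + ennreal (1 / K) * (?L g * ?L g) \<partial>upper_normal n)"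
    by (intro nn_integral_mono le)
  also have "\<dots> = ennreal K * (\<integral>\<^sup>+g. ?I g \<partial>upper_normal n) +
      ennreal (1 / K) * (\<integral>\<^sup>+g. ?L g * ?L g \<partial>upper_normal n)"
    by (subst nn_integral_add) (auto simp: nn_integral_cmult)
  also have "(\<integral>\<^sup>+g. ?I g \<partial>upper_normal n) = emeasure (GWig n 0 (iid_prior \<pi>)) A"
    by (simp add: emeasure_GWig[OF n A] likelihood_0)
  finally show ?thesis
    by (rule order_trans) (intro add_left_mono mult_left_mono C, simp)
qed

text \<open>The preceding bound gives \<open>P(A) \<le> K * Q(A) + C / K\<close> with
  \<open>C\<close> independent of \<open>n\<close>. A large \<open>K\<close> makes the second term
  small, and afterwards a large \<open>n\<close> the first.\<close>

lemma contiguous_GWig: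
  assumes C: "\<And>n. n > 0 \<Longrightarrow>
    (\<integral>\<^sup>+g. likelihood n lam \<pi> g * likelihood n lam \<pi> g \<partial>upper_normal n) \<le> ennreal C"
  shows "contiguous (\<lambda>n. GWig n lam (iid_prior \<pi>)) (\<lambda>n. GWig n 0 (iid_prior \<pi>))"
  unfolding contiguous_def
proof (intro allI impI)
  fix A :: "nat \<Rightarrow> (nat \<times> nat \<Rightarrow> real) set"
  let ?P = "\<lambda>n. GWig n lam (iid_prior \<pi>)" and ?Q = "\<lambda>n. GWig n 0 (iid_prior \<pi>)"
  assume "\<forall>n. A n \<in> sets (?Q n)" and Q: "(\<lambda>n. measure (?Q n) (A n)) \<longlonglongrightarrow> 0"
  then have A: "A n \<in> sets (mat_space n)" for n
    by (simp add: sets_GWig)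
  \<comment> \<open>The constant \<open>C\<close> may be zero or negative; a positive bound is
    needed for the cutoff \<open>K\<close> below to be positive.\<close>
  define D where "D = max C 1"
  have D: "D > 0" "C \<le> D" by (auto simp: D_def)
  have le: "measure (?P n) (A n) \<le> K * measure (?Q n) (A n) + D / K" if "n > 0" "K > 0" for n K
  proof -
    interpret P: prob_space "?P n" by (rule prob_space_GWig)
    interpret Q: prob_space "?Q n" by (rule prob_space_GWig)
    have "ennreal (measure (?P n) (A n)) \<le>
        ennreal K * ennreal (measure (?Q n) (A n)) + ennreal (1 / K) * ennreal D"
      using emeasure_GWig_le[OF that(1) A that(2), of lam \<pi> D] C[OF that(1)] D
      unfolding P.emeasure_eq_measure Q.emeasure_eq_measure
      by (meson ennreal_leI order_trans)
    also have "\<dots> = ennreal (K * measure (?Q n) (A n) + D / K)"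
      using that D by (simp add: ennreal_mult'[symmetric] ennreal_plus[symmetric] del: ennreal_plus)
    finally show ?thesis
      using that D by (subst (asm) ennreal_le_iff) auto
  qed
  show "(\<lambda>n. measure (?P n) (A n)) \<longlonglongrightarrow> 0"
  proof (rule LIMSEQ_I)
    fix e :: real assume e: "e > 0"
    \<comment> \<open>This choice makes \<open>D / K\<close> equal to \<open>e / 2\<close>, leaving
      \<open>e / 2\<close> for the term with the null probability.\<close>
    define K where "K = 2 * D / e"
    have K: "K > 0" using e D by (simp add: K_def)
    have "eventually (\<lambda>n. measure (?Q n) (A n) < e / (2 * K)) sequentially"
      using Q e K by (intro order_tendstoD) auto
    then have "eventually (\<lambda>n. measure (?P n) (A n) < e) sequentially"
      using eventually_gt_at_top[of 0]
    proof eventually_elim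
      case (elim n)
      have "K * measure (?Q n) (A n) < e / 2"
        using elim(1) K by (simp add: field_simps)
      moreover have "D / K = e / 2"
        using e D by (simp add: K_def)
      ultimately show ?case
        using le[OF elim(2) K] by simp
    qed
    then show "\<exists>no. \<forall>n\<ge>no. norm (measure (?P n) (A n) - 0) < e"
      by (simp add: eventually_sequentially)
  qed
qed

section \<open>The second moment for the sparse Rademacher prior\<close>

lemma nn_integral_exp_normal:
  "(\<integral>\<^sup>+g. ennreal (exp (m * g)) \<partial>density lborel (normal_density 0 1)) = ennreal (exp (m\<^sup>2 / 2))"
proof -
  have "ennreal (exp (m * g)) = ennreal (exp (m\<^sup>2 / 2)) * ennreal (tilt 1 m g)" for g
    by (simp add: ennreal_mult'[symmetric] tilt_def exp_add[symmetric])
  then have "(\<integral>\<^sup>+g. ennreal (exp (m * g)) \<partial>density lborel (normal_density 0 1)) =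
      (\<integral>\<^sup>+g. ennreal (exp (m\<^sup>2 / 2)) * ennreal (tilt 1 m g) \<partial>density lborel (normal_density 0 1))"
    by simp
  also have "\<dots> = ennreal (exp (m\<^sup>2 / 2))"
    by (subst nn_integral_cmult) (auto simp: nn_integral_tilt)
  finally show ?thesis .
qed

text \<open>The integrand times the standard Gaussian density is, up to the factor \<open>s\<close>,
  the density of a centred Gaussian with variance \<open>1 / (1 - l^2)\<close>. This is where the
  signal strength must stay below 1.\<close>

lemma nn_integral_exp_square_normal:
  fixes l :: real
  assumes "0 \<le> l" "l < 1"
  shows "(\<integral>\<^sup>+g. ennreal (exp (l\<^sup>2 * g\<^sup>2 / 2)) \<partial>density lborel (normal_density 0 1)) =
    ennreal (1 / sqrt (1 - l\<^sup>2))"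
proof -
  define s where "s = 1 / sqrt (1 - l\<^sup>2)"
  have l: "1 - l\<^sup>2 > 0"
    using power_strict_mono[of l 1 2] assms by simp
  then have s: "s > 0" "s\<^sup>2 = 1 / (1 - l\<^sup>2)"
    by (auto simp: s_def power_divide)
  have eq: "normal_density 0 1 g * exp (l\<^sup>2 * g\<^sup>2 / 2) = s * normal_density 0 s g" for g
  proof -
    have "exp (- g\<^sup>2 / 2) * exp (l\<^sup>2 * g\<^sup>2 / 2) = exp (- g\<^sup>2 / (2 * s\<^sup>2))"
      by (simp add: s exp_add[symmetric] field_simps)
    moreover have "sqrt (2 * pi * s\<^sup>2) = s * sqrt (2 * pi)"
      using s(1) by (simp add: real_sqrt_mult)
    ultimately show ?thesis
      using s(1) by (simp add: normal_density_def)
  qed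
  have "(\<integral>\<^sup>+g. ennreal (exp (l\<^sup>2 * g\<^sup>2 / 2)) \<partial>density lborel (normal_density 0 1)) =
      (\<integral>\<^sup>+g. ennreal s * ennreal (normal_density 0 s g) \<partial>lborel)"
    using s(1) by (subst nn_integral_density) (auto simp: ennreal_mult'[symmetric] eq)
  also have "\<dots> = ennreal s * emeasure (density lborel (normal_density 0 s)) UNIV"
    by (subst nn_integral_cmult) (auto simp: emeasure_density)
  also have "\<dots> = ennreal s"
    using prob_space.emeasure_space_1[OF prob_space_normal_density[OF s(1), of 0]] by simp
  finally show ?thesis
    by (simp add: s_def)
qed

section \<open>Integrals over the sparse Rademacher prior\<close>

lemma nn_integral_sparse_rademacher:
  assumes "0 \<le> \<rho>" "\<rho> \<le> 1" and f: "\<And>x. 0 \<le> f x"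
  shows "(\<integral>\<^sup>+r. ennreal (f r) \<partial>measure_pmf (sparse_rademacher \<rho>)) =
    ennreal ((1 - \<rho>) * f 0 + \<rho> / 2 * f 1 + \<rho> / 2 * f (- 1))"
proof -
  have "(\<integral>\<^sup>+r. ennreal (f r) \<partial>measure_pmf (sparse_rademacher \<rho>)) =
      ennreal \<rho> * (ennreal (1 / 2) * ennreal (f 1) + ennreal (1 / 2) * ennreal (f (- 1))) +
      ennreal (1 - \<rho>) * ennreal (f 0)"
    using assms by (simp add: sparse_rademacher_def nn_integral_bernoulli_pmf mult.commute)
  also have "\<dots> = ennreal (\<rho> * (1 / 2 * f 1 + 1 / 2 * f (- 1)) + (1 - \<rho>) * f 0)"
  proof -
    have "ennreal a * (ennreal h * ennreal b + ennreal h * ennreal c) + ennreal d * ennreal e =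
        ennreal (a * (h * b + h * c) + d * e)"
      if "0 \<le> a" "0 \<le> b" "0 \<le> c" "0 \<le> d" "0 \<le> e" "0 \<le> h" for a b c d e h :: real
      using that by (simp add: ennreal_mult)
    then show ?thesis
      using assms by (simp only: le_diff_eq add_0 zero_le_divide_1_iff zero_le_numeral)
  qed
  also have "\<rho> * (1 / 2 * f 1 + 1 / 2 * f (- 1)) + (1 - \<rho>) * f 0 =
      (1 - \<rho>) * f 0 + \<rho> / 2 * f 1 + \<rho> / 2 * f (- 1)"
    by (simp add: algebra_simps)
  finally show ?thesis .
qed

text \<open>By independence the integral factorises. The scalings \<open>1 / sqrt n\<close> and
  \<open>sqrt (1 / \<rho>)\<close> combine, so a nonzero coordinate equals plus or minus
  \<open>1 / sqrt (n * \<rho>)\<close>.\<close>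

lemma nn_integral_sparse_prior_prod:
  assumes "0 < \<rho>" "\<rho> \<le> 1" and f: "\<And>i x. 0 \<le> f i x" and [measurable]: "\<And>i. f i \<in> borel_measurable borel"
  shows "(\<integral>\<^sup>+x. (\<Prod>i<n. ennreal (f i (x i))) \<partial>sparse_rademacher_prior \<rho> n) =
    (\<Prod>i<n. ennreal ((1 - \<rho>) * f i 0 + \<rho> / 2 * f i (1 / sqrt (n * \<rho>)) + \<rho> / 2 * f i (- 1 / sqrt (n * \<rho>))))"
proof -
  let ?\<pi> = "map_pmf (\<lambda>r. sqrt (1 / \<rho>) * r) (sparse_rademacher \<rho>)"
  let ?\<nu> = "distr (measure_pmf ?\<pi>) borel (\<lambda>z. 1 / sqrt (real n) * z)"
  interpret product_sigma_finite "\<lambda>_::nat. ?\<nu>"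
    unfolding product_sigma_finite_def
    by (intro allI prob_space_imp_sigma_finite prob_space.prob_space_distr measure_pmf.prob_space_axioms) simp
  have eq: "(\<integral>\<^sup>+z. ennreal (f i z) \<partial>?\<nu>) =
      ennreal ((1 - \<rho>) * f i 0 + \<rho> / 2 * f i (1 / sqrt (n * \<rho>)) + \<rho> / 2 * f i (- 1 / sqrt (n * \<rho>)))" for i
  proof -
    have "(\<integral>\<^sup>+z. ennreal (f i z) \<partial>?\<nu>) =
        (\<integral>\<^sup>+r. ennreal (f i (1 / sqrt (real n) * (sqrt (1 / \<rho>) * r))) \<partial>measure_pmf (sparse_rademacher \<rho>))"
      by (subst nn_integral_distr) (auto simp: nn_integral_map_pmf)
    also have "\<dots> = ennreal ((1 - \<rho>) * f i 0 + \<rho> / 2 * f i (1 / sqrt (n * \<rho>)) + \<rho> / 2 * f i (- 1 / sqrt (n * \<rho>)))"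
      using assms by (subst nn_integral_sparse_rademacher) (auto simp: real_sqrt_divide real_sqrt_mult)
    finally show ?thesis .
  qed
  have "(\<integral>\<^sup>+x. (\<Prod>i<n. ennreal (f i (x i))) \<partial>sparse_rademacher_prior \<rho> n) =
      (\<Prod>i<n. \<integral>\<^sup>+z. ennreal (f i z) \<partial>?\<nu>)"
    unfolding sparse_rademacher_prior_def iid_prior_def
    by (rule product_nn_integral_prod[where f = "\<lambda>i z. ennreal (f i z)"]) auto
  then show ?thesis
    by (simp only: eq)
qed

text \<open>A product \<open>x i * x' i\<close> is nonzero with probability \<open>\<rho>^2\<close>,
  and then it is plus or minus \<open>1 / (n * \<rho>)\<close> with equal chances. The right side is
  the \<open>n\<close>-th power of its moment generating function at \<open>c\<close>.\<close>

lemma nn_integral_sparse_prior_exp_inner: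
  assumes "0 < \<rho>" "\<rho> \<le> 1" and n: "n > 0"
  shows "(\<integral>\<^sup>+x. \<integral>\<^sup>+x'. ennreal (exp (c * (\<Sum>i<n. x i * x' i)))
      \<partial>sparse_rademacher_prior \<rho> n \<partial>sparse_rademacher_prior \<rho> n) =
    ennreal ((1 - \<rho>\<^sup>2 + \<rho>\<^sup>2 * cosh (c / n / \<rho>)) ^ n)"
proof -
  let ?a = "1 / sqrt (n * \<rho>)"
  \<comment> \<open>This is the average of \<open>exp (c * z * x' i)\<close> over one coordinate of
    the second copy, with \<open>z\<close> the corresponding coordinate of the first.\<close>
  let ?h = "\<lambda>z. 1 - \<rho> + \<rho> * cosh (c * z * ?a)"
  have h0: "0 \<le> ?h z" for z
    using assms by (intro add_nonneg_nonneg mult_nonneg_nonneg) (auto intro: order_trans[OF _ cosh_real_ge_1])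
  have aa: "?a * ?a = 1 / (n * \<rho>)"
    using assms by simp
  have "(\<integral>\<^sup>+x'. ennreal (exp (c * (\<Sum>i<n. x i * x' i))) \<partial>sparse_rademacher_prior \<rho> n) =
      (\<Prod>i<n. ennreal (?h (x i)))" for x
  proof -
    have "(\<integral>\<^sup>+x'. ennreal (exp (c * (\<Sum>i<n. x i * x' i))) \<partial>sparse_rademacher_prior \<rho> n) =
        (\<integral>\<^sup>+x'. (\<Prod>i<n. ennreal (exp (c * x i * x' i))) \<partial>sparse_rademacher_prior \<rho> n)"
      by (simp add: prod_ennreal exp_sum sum_distrib_left mult.assoc)
    also have "\<dots> = (\<Prod>i<n. ennreal (?h (x i)))"
      using assms by (subst nn_integral_sparse_prior_prod) (auto simp: cosh_def field_simps)
    finally show ?thesis .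
  qed
  then have "(\<integral>\<^sup>+x. \<integral>\<^sup>+x'. ennreal (exp (c * (\<Sum>i<n. x i * x' i)))
      \<partial>sparse_rademacher_prior \<rho> n \<partial>sparse_rademacher_prior \<rho> n) =
      (\<integral>\<^sup>+x. (\<Prod>i<n. ennreal (?h (x i))) \<partial>sparse_rademacher_prior \<rho> n)"
    by simp
  also have "\<dots> = (\<Prod>i<n. ennreal ((1 - \<rho>) * ?h 0 + \<rho> / 2 * ?h ?a + \<rho> / 2 * ?h (- 1 / sqrt (n * \<rho>))))"
    using assms(1,2) h0
    by (rule nn_integral_sparse_prior_prod) (simp add: cosh_def)
  also have "(1 - \<rho>) * ?h 0 + \<rho> / 2 * ?h ?a + \<rho> / 2 * ?h (- 1 / sqrt (n * \<rho>)) =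
      1 - \<rho>\<^sup>2 + \<rho>\<^sup>2 * cosh (c / n / \<rho>)"
  proof -
    have 1: "c * ?a * ?a = c / n / \<rho>"
      using aa by (simp add: mult.assoc)
    have 2: "c * (- 1 / sqrt (n * \<rho>)) * ?a = - (c * ?a * ?a)"
      by simp
    show ?thesis
      unfolding 2 cosh_minus 1 by (simp add: algebra_simps power2_eq_square)
  qed
  also have "(\<Prod>i<n. ennreal (1 - \<rho>\<^sup>2 + \<rho>\<^sup>2 * cosh (c / n / \<rho>))) =
      ennreal ((1 - \<rho>\<^sup>2 + \<rho>\<^sup>2 * cosh (c / n / \<rho>)) ^ n)"
  proof -
    have "0 \<le> 1 - \<rho>\<^sup>2 + \<rho>\<^sup>2 * cosh (c / n / \<rho>)"
      using assms by (intro add_nonneg_nonneg) (auto simp: power_le_one)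
    then show ?thesis
      by (simp only: prod_constant card_lessThan ennreal_power)
  qed
  finally show ?thesis .
qed

text \<open>
  Writing \<open>exp (s\<^sup>2 / 2)\<close> as a Gaussian average of \<open>exp (s g)\<close> makes the square linear, so that the
  expectation over the two copies of the prior factorises over coordinates.
\<close>

lemma second_moment_bound:
  assumes \<rho>: "1 / sqrt 3 \<le> \<rho>" "\<rho> \<le> 1" and l: "0 \<le> l" "l < 1" and n: "n > 0"
  shows "(\<integral>\<^sup>+x. \<integral>\<^sup>+x'. ennreal (exp ((sqrt (real n) * l * (\<Sum>i<n. x i * x' i))\<^sup>2 / 2))
      \<partial>sparse_rademacher_prior \<rho> n \<partial>sparse_rademacher_prior \<rho> n) \<le> ennreal (1 / sqrt (1 - l\<^sup>2))"
proof -
  have pos: "0 < \<rho>"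
    using \<rho> by (smt (verit) divide_pos_pos real_sqrt_gt_0_iff)
  let ?X = "sparse_rademacher_prior \<rho> n" and ?N = "density lborel (normal_density 0 1)"
  let ?e = "\<lambda>x x' g. ennreal (exp (sqrt (real n) * l * g * (\<Sum>i<n. x i * x' i)))"
  interpret X: prob_space ?X
    unfolding sparse_rademacher_prior_def by (rule prob_space_iid_prior)
  interpret N: prob_space ?N by (rule prob_space_normal_density) simp
  interpret NX: pair_sigma_finite ?N ?X ..
  have comp: "(\<lambda>x. x i) \<in> borel_measurable ?X" if "i < n" for i
    unfolding sparse_rademacher_prior_def using that by (rule measurable_prior_component)
  have meas: "(\<lambda>z. ?e (fst (fst z)) (snd (fst z)) (snd z)) \<in> borel_measurable ((?X \<Otimes>\<^sub>M ?X) \<Otimes>\<^sub>M ?N)"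
  proof -
    have [measurable]: "(\<lambda>z. fst (fst z) i) \<in> borel_measurable ((?X \<Otimes>\<^sub>M ?X) \<Otimes>\<^sub>M ?N)"
      if "i < n" for i
      by (rule measurable_compose[OF measurable_compose[OF measurable_fst measurable_fst] comp[OF that]])
    have [measurable]: "(\<lambda>z. snd (fst z) i) \<in> borel_measurable ((?X \<Otimes>\<^sub>M ?X) \<Otimes>\<^sub>M ?N)"
      if "i < n" for i
      by (rule measurable_compose[OF measurable_compose[OF measurable_fst measurable_snd] comp[OF that]])
    show ?thesis by measurable
  qed
  \<comment> \<open>The two exchanges move the auxiliary Gaussian variable outermost, past
    \<open>x'\<close> and then past \<open>x\<close>, so that for fixed \<open>g\<close> the
    integral over both copies is the one computed above.\<close>
  have swap1: "(\<integral>\<^sup>+x'. \<integral>\<^sup>+g. ?e x x' g \<partial>?N \<partial>?X) = (\<integral>\<^sup>+g. \<integral>\<^sup>+x'. ?e x x' g \<partial>?X \<partial>?N)"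
    if "x \<in> space ?X" for x
  proof (rule NX.Fubini')
    have "(\<lambda>z. ((x, snd z), fst z)) \<in> measurable (?N \<Otimes>\<^sub>M ?X) ((?X \<Otimes>\<^sub>M ?X) \<Otimes>\<^sub>M ?N)"
      using that by measurable
    from measurable_compose[OF this meas]
    show "(\<lambda>(g, x'). ?e x x' g) \<in> borel_measurable (?N \<Otimes>\<^sub>M ?X)"
      by (simp add: case_prod_unfold)
  qed
  have swap2: "(\<integral>\<^sup>+x. \<integral>\<^sup>+g. \<integral>\<^sup>+x'. ?e x x' g \<partial>?X \<partial>?N \<partial>?X) = (\<integral>\<^sup>+g. \<integral>\<^sup>+x. \<integral>\<^sup>+x'. ?e x x' g \<partial>?X \<partial>?X \<partial>?N)"
  proof (rule NX.Fubini')
    have "(\<lambda>w. ((snd (fst w), snd w), fst (fst w)))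
        \<in> measurable ((?N \<Otimes>\<^sub>M ?X) \<Otimes>\<^sub>M ?X) ((?X \<Otimes>\<^sub>M ?X) \<Otimes>\<^sub>M ?N)"
      by measurable
    from X.borel_measurable_nn_integral_fst[OF measurable_compose[OF this meas]]
    show "(\<lambda>(g, x). \<integral>\<^sup>+x'. ?e x x' g \<partial>?X) \<in> borel_measurable (?N \<Otimes>\<^sub>M ?X)"
      by (simp add: case_prod_unfold)
  qed
  have "(\<integral>\<^sup>+x. \<integral>\<^sup>+x'. ennreal (exp ((sqrt (real n) * l * (\<Sum>i<n. x i * x' i))\<^sup>2 / 2)) \<partial>?X \<partial>?X) =
      (\<integral>\<^sup>+x. \<integral>\<^sup>+x'. \<integral>\<^sup>+g. ?e x x' g \<partial>?N \<partial>?X \<partial>?X)"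
    by (simp only: nn_integral_exp_normal[symmetric] mult_ac)
  also have "\<dots> = (\<integral>\<^sup>+x. \<integral>\<^sup>+g. \<integral>\<^sup>+x'. ?e x x' g \<partial>?X \<partial>?N \<partial>?X)"
    by (intro nn_integral_cong swap1)
  also have "\<dots> = (\<integral>\<^sup>+g. \<integral>\<^sup>+x. \<integral>\<^sup>+x'. ?e x x' g \<partial>?X \<partial>?X \<partial>?N)"
    by (rule swap2)
  also have "\<dots> \<le> (\<integral>\<^sup>+g. ennreal (exp (l\<^sup>2 * g\<^sup>2 / 2)) \<partial>?N)"
  proof (rule nn_integral_mono)
    fix g
    \<comment> \<open>This is \<open>c / n\<close> for \<open>c = sqrt n * l * g\<close>. Its square
      is \<open>l^2 * g^2 / n\<close>, so the \<open>n\<close>-th power of the subgaussian bound no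
      longer depends on \<open>n\<close>.\<close>
    let ?t = "sqrt (real n) * l * g / n"
    have "(1 - \<rho>\<^sup>2 + \<rho>\<^sup>2 * cosh (?t / \<rho>)) ^ n \<le> exp (?t\<^sup>2 / 2) ^ n"
      using \<rho> pos by (intro power_mono sparse_cosh_le_exp add_nonneg_nonneg) (auto simp: power_le_one)
    also have "\<dots> = exp (l\<^sup>2 * g\<^sup>2 / 2)"
      using n by (simp add: exp_of_nat_mult[symmetric] power_mult_distrib power_divide field_simps power2_eq_square)
    finally show "(\<integral>\<^sup>+x. \<integral>\<^sup>+x'. ?e x x' g \<partial>?X \<partial>?X) \<le> ennreal (exp (l\<^sup>2 * g\<^sup>2 / 2))"
      unfolding nn_integral_sparse_prior_exp_inner[OF pos \<rho>(2) n] by (rule ennreal_leI)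
  qed
  also have "\<dots> = ennreal (1 / sqrt (1 - l\<^sup>2))"
    by (rule nn_integral_exp_square_normal[OF l])
  finally show ?thesis .
qed

theorem theorem3p13:
  fixes \<rho> :: real
  assumes "0 < \<rho>" and "\<rho> \<le> 1"
  shows "(1 / sqrt 3 \<le> \<rho> \<longrightarrow>
            sigma_star \<rho> = 1 \<and>
            (\<forall>lam::real. 0 \<le> lam \<and> lam < 1 \<longrightarrow>
               contiguous (\<lambda>n. GWig n lam (sparse_rademacher_prior \<rho>))
                          (\<lambda>n. GWig n 0 (sparse_rademacher_prior \<rho>)))) \<and>
         (\<rho> < 1 / sqrt 3 \<longrightarrow> sigma_star \<rho> > 1)"
proof (intro conjI impI allI)
  assume "1 / sqrt 3 \<le> \<rho>"
  then show "sigma_star \<rho> = 1"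
    using assms by (intro sigma_star_eq_1)
next
  fix lam :: real
  assume "1 / sqrt 3 \<le> \<rho>" "0 \<le> lam \<and> lam < 1"
  then show "contiguous (\<lambda>n. GWig n lam (sparse_rademacher_prior \<rho>))
      (\<lambda>n. GWig n 0 (sparse_rademacher_prior \<rho>))"
    \<comment> \<open>The second moment bound \<open>1 / sqrt (1 - lam^2)\<close> is free of
      \<open>n\<close>, as the contiguity criterion demands.\<close>
    using second_moment_bound[of \<rho> lam] assms
    unfolding sparse_rademacher_prior_def
    by (intro contiguous_GWig[where C = "1 / sqrt (1 - lam\<^sup>2)"]) (simp add: second_moment_likelihood)
next
  assume "\<rho> < 1 / sqrt 3"
  then show "sigma_star \<rho> > 1"
    using assms by (intro sigma_star_gt_1)
qed

end
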